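(* Let $X$ be a complex nonzero Banach space, $T\in L(X)$, and $b:\mathbb N\to\mathbb R$ be a sequence of strictly positive real numbers such that $\mathcal H(b)<+\infty$, $\lim_{n\to+\infty}b(n)=+\infty$ and $\lim_{n\to+\infty}\frac{\|T^n\|_{L(X)}}{b(n)}=0$. Then $r(T)\le 1$. Furthermore, if $s:\mathbb N\to\mathbb R$ is any nondecreasing sequence of strictly positive real numbers such that $\lim_{n\to+\infty}s(n)=+\infty$, $\lim_{n\to+\infty}\frac{s(n+1)}{s(n)}=1$, $\Delta^q s\in\ell_1$ for some integer $q\ge 2$, and the sequence $\bigl(\frac{b(n)}{s(n)}\bigr)_{n\in\mathbb N}$ is bounded, then $\lim_{n\to+\infty}\frac{\|T^n\|_{L(X)}}{s(n)}=0$, and the following conditions are equivalent: (1) the sequence $\Bigl(\frac{1}{s(n)}\sum_{k=0}^n(\Delta s)(n-k)\,T^k\Bigr)_{n\in\mathbb N}$ converges in $L(X)$; (2) $1$ is either in $\rho(T)$, or a simple pole of $\mathfrak R_T$; (3) $X=\mathcal N(I_X-T)\oplus\mathcal R(I_X-T)$; (4) $\mathcal R(I_X-T)$ is closed in $X$ and $X=\mathcal N(I_X-T)\oplus\mathcal R(I_X-T)$. Finally, if the equivalent conditions (1)-(4) are satisfied and $P\in L(X)$ is such that $\frac{1}{s(n)}\sum_{k=0}^n(\Delta s)(n-k)\,T^k\longrightarrow P$ in $L(X)$ as $n\to+\infty$, then $P$ is the projection of $X$ onto $\mathcal N(I_X-T)$ along $\mathcal R(I_X-T)$.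
   Context: $\mathbb N$ is the set of nonnegative integers and $\mathbb Z_+$ the set of strictly positive integers. The linear operator $\Delta$ on scalar sequences indexed by $\mathbb N$ is defined by $(\Delta a)(0)=a(0)$ and $(\Delta a)(n)=a(n)-a(n-1)$ for $n\in\mathbb Z_+$; $\Delta^q$ is its $q$-th iterate. $\ell_1$ is the space of absolutely summable sequences indexed by $\mathbb N$. For a real sequence $a:\mathbb N\to\mathbb R$, $\mathcal H(a)=\inf\{m\in\mathbb N:\ (a(n)/n^m)_{n\in\mathbb Z_+}\text{ is bounded from above}\}\in\mathbb N\cup\{+\infty\}$ (with $\inf\emptyset=+\infty$). $L(X)$ is the Banach algebra of bounded linear operators on $X$, and convergence in $L(X)$ means convergence in operator norm. $I_X$ is the identity operator; $\mathcal N(\cdot)$ and $\mathcal R(\cdot)$ denote kernel and range. $\sigma(T)$, $r(T)$ and $\rho(T)=\mathbb C\setminus\sigma(T)$ are the spectrum, spectral radius and resolvent set of $T$, and $\mathfrak R_T:\rho(T)\ni\lambda\mapsto(\lambda I_X-T)^{-1}\in L(X)$ is the resolvent function. The direct sum $X=Y\oplus Z$ is algebraic: $Y+Z=X$, $Y\cap Z=\{0\}$. For closed subspaces $Y,Z$ with $X=Y\oplus Z$, the projection of $X$ onto $Y$ along $Z$ is the bounded linear map $P$ with $Px\in Y$ and $x-Px\in Z$ for all $x\in X$. *)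

theory Defs
  imports "HOL-Analysis.Analysis" "HOL-Library.Extended_Nat"
begin

section \<open>Complex Banach spaces\<close>

text \<open>The norm and the real scalar multiplication are those of the class \<open>banach\<close>; the complex
  scalar multiplication extends the latter.\<close>

class complex_banach = banach +
  fixes scaleC :: "complex \<Rightarrow> 'a \<Rightarrow> 'a"  (infixr \<open>*\<^sub>C\<close> 75)
  assumes scaleC_add_right: "c *\<^sub>C (x + y) = c *\<^sub>C x + c *\<^sub>C y"
    and scaleC_add_left: "(c + d) *\<^sub>C x = c *\<^sub>C x + d *\<^sub>C x"
    and scaleC_scaleC: "c *\<^sub>C d *\<^sub>C x = (c * d) *\<^sub>C x"
    and scaleR_scaleC: "r *\<^sub>R x = complex_of_real r *\<^sub>C x"
    and norm_scaleC: "norm (c *\<^sub>C x) = cmod c * norm x"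

instantiation complex :: complex_banach
begin

definition scaleC_complex :: "complex \<Rightarrow> complex \<Rightarrow> complex"
  where "scaleC_complex c x = c * x"

instance
  by standard (auto simp: scaleC_complex_def algebra_simps norm_mult scaleR_conv_of_real)

end

lemma bounded_linear_scaleC_right: "bounded_linear (\<lambda>x::'a::complex_banach. c *\<^sub>C x)"
  by (rule bounded_linear_intro[where K = "cmod c"])
    (auto simp: scaleC_add_right scaleR_scaleC scaleC_scaleC norm_scaleC mult.commute)

instantiation blinfun :: (real_normed_vector, complex_banach) complex_banach
begin

lift_definition scaleC_blinfun :: "complex \<Rightarrow> 'a \<Rightarrow>\<^sub>L 'b \<Rightarrow> 'a \<Rightarrow>\<^sub>L 'b"
  is "\<lambda>c A x. c *\<^sub>C A x"
  by (rule bounded_linear_compose[OF bounded_linear_scaleC_right])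

instance
proof
  fix c d :: complex and r :: real and A B :: "'a \<Rightarrow>\<^sub>L 'b"
  show "c *\<^sub>C (A + B) = c *\<^sub>C A + c *\<^sub>C B"
    by transfer (simp add: scaleC_add_right)
  show "(c + d) *\<^sub>C A = c *\<^sub>C A + d *\<^sub>C A"
    by transfer (simp add: scaleC_add_left)
  have assoc: "e *\<^sub>C f *\<^sub>C C = (e * f) *\<^sub>C C" for e f and C :: "'a \<Rightarrow>\<^sub>L 'b"
    by transfer (simp add: scaleC_scaleC)
  then show "c *\<^sub>C d *\<^sub>C A = (c * d) *\<^sub>C A" .
  show "r *\<^sub>R A = complex_of_real r *\<^sub>C A"
    by transfer (simp add: scaleR_scaleC)
  have le: "norm (e *\<^sub>C C) \<le> cmod e * norm C" for e and C :: "'a \<Rightarrow>\<^sub>L 'b"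
  proof (rule norm_blinfun_bound)
    fix x
    show "norm (blinfun_apply (e *\<^sub>C C) x) \<le> cmod e * norm C * norm x"
      using norm_blinfun[of C x]
      by (simp add: scaleC_blinfun.rep_eq norm_scaleC mult.assoc mult_left_mono)
  qed simp
  show "norm (c *\<^sub>C A) = cmod c * norm A"
  proof (cases "c = 0")
    case True
    then show ?thesis using le[of 0 A] by simp
  next
    case False
    have one: "1 *\<^sub>C A = A"
    proof -
      have "1 *\<^sub>C blinfun_apply A x = blinfun_apply A x" for x
        using scaleR_scaleC[of 1 "blinfun_apply A x"] by simp
      then show ?thesis by (intro blinfun_eqI) (simp add: scaleC_blinfun.rep_eq)
    qed
    have "norm A = norm (inverse c *\<^sub>C c *\<^sub>C A)"
      using False one assoc by simp
    also have "\<dots> \<le> cmod (inverse c) * norm (c *\<^sub>C A)" by (rule le)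
    finally have "cmod c * norm A \<le> norm (c *\<^sub>C A)"
      using False by (simp add: norm_inverse norm_divide field_simps)
    with le[of c A] show ?thesis by simp
  qed
qed

end


section \<open>Bounded operators, spectrum and resolvent\<close>

text \<open>The library type of bounded linear maps consists of the real-linear ones. The algebra $L(X)$
  is the set of its complex-linear elements; the norm and the topology are inherited.\<close>

definition L_ops :: "('a::complex_banach \<Rightarrow>\<^sub>L 'a) set"
  where "L_ops = {A. \<forall>c x. blinfun_apply A (c *\<^sub>C x) = c *\<^sub>C blinfun_apply A x}"

definition blinfun_power :: "('a::real_normed_vector \<Rightarrow>\<^sub>L 'a) \<Rightarrow> nat \<Rightarrow> ('a \<Rightarrow>\<^sub>L 'a)"
  where "blinfun_power T n = ((o\<^sub>L) T ^^ n) id_blinfun"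

definition is_inverse_op :: "('a::complex_banach \<Rightarrow>\<^sub>L 'a) \<Rightarrow> ('a \<Rightarrow>\<^sub>L 'a) \<Rightarrow> bool"
  where "is_inverse_op A S \<longleftrightarrow> S \<in> L_ops \<and> S o\<^sub>L A = id_blinfun \<and> A o\<^sub>L S = id_blinfun"

definition resolvent_set :: "('a::complex_banach \<Rightarrow>\<^sub>L 'a) \<Rightarrow> complex set"
  where "resolvent_set T = {z. \<exists>S. is_inverse_op (z *\<^sub>C id_blinfun - T) S}"

definition op_spectrum :: "('a::complex_banach \<Rightarrow>\<^sub>L 'a) \<Rightarrow> complex set"
  where "op_spectrum T = - resolvent_set T"

text \<open>Meaningful for operators on a nonzero space, whose spectrum is nonempty and bounded.\<close>

definition op_spectral_radius :: "('a::complex_banach \<Rightarrow>\<^sub>L 'a) \<Rightarrow> real"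
  where "op_spectral_radius T = Sup (cmod ` op_spectrum T)"

text \<open>Meaningful only on \<open>resolvent_set T\<close>.\<close>

definition resolvent :: "('a::complex_banach \<Rightarrow>\<^sub>L 'a) \<Rightarrow> complex \<Rightarrow> ('a \<Rightarrow>\<^sub>L 'a)"
  where "resolvent T z = (THE S. is_inverse_op (z *\<^sub>C id_blinfun - T) S)"

text \<open>\<open>a\<close> is a pole of order \<open>k\<close> of the vector-valued function \<open>f\<close> with domain \<open>D\<close>: in a punctured
  disc around \<open>a\<close>, \<open>f\<close> has the Laurent expansion
  \<open>f z = (\<Sum>m \<ge> -k. (z - a)\<^sup>m c\<^sub>m)\<close> with \<open>c\<^sub>-\<^sub>k \<noteq> 0\<close>.\<close>

definition pole_of_order ::
    "nat \<Rightarrow> (complex \<Rightarrow> 'b::complex_banach) \<Rightarrow> complex set \<Rightarrow> complex \<Rightarrow> bool"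
  where "pole_of_order k f D a \<longleftrightarrow> 1 \<le> k \<and> a \<notin> D \<and>
    (\<exists>r>0. \<exists>c :: int \<Rightarrow> 'b. c (- int k) \<noteq> 0 \<and>
      (\<forall>z. 0 < cmod (z - a) \<and> cmod (z - a) < r \<longrightarrow> z \<in> D \<and>
        (\<lambda>n. ((z - a) powi (int n - int k)) *\<^sub>C c (int n - int k)) sums f z))"

abbreviation simple_pole :: "(complex \<Rightarrow> 'b::complex_banach) \<Rightarrow> complex set \<Rightarrow> complex \<Rightarrow> bool"
  where "simple_pole \<equiv> pole_of_order 1"

definition op_kernel :: "('a::real_normed_vector \<Rightarrow>\<^sub>L 'b::real_normed_vector) \<Rightarrow> 'a set"
  where "op_kernel A = {x. blinfun_apply A x = 0}"

abbreviation op_range :: "('a::real_normed_vector \<Rightarrow>\<^sub>L 'b::real_normed_vector) \<Rightarrow> 'b set"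
  where "op_range A \<equiv> range (blinfun_apply A)"

definition direct_sum_decomp :: "'a::real_normed_vector set \<Rightarrow> 'a set \<Rightarrow> bool"
  where "direct_sum_decomp Y Z \<longleftrightarrow> {y + z | y z. y \<in> Y \<and> z \<in> Z} = UNIV \<and> Y \<inter> Z = {0}"

definition is_projection :: "('a::complex_banach \<Rightarrow>\<^sub>L 'a) \<Rightarrow> 'a set \<Rightarrow> 'a set \<Rightarrow> bool"
  where "is_projection P Y Z \<longleftrightarrow>
    closed Y \<and> closed Z \<and> direct_sum_decomp Y Z \<and> P \<in> L_ops \<and>
    (\<forall>x. blinfun_apply P x \<in> Y \<and> x - blinfun_apply P x \<in> Z)"


section \<open>Sequences\<close>

definition Delta :: "(nat \<Rightarrow> 'a::ab_group_add) \<Rightarrow> nat \<Rightarrow> 'a"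
  where "Delta a n = (if n = 0 then a 0 else a n - a (n - 1))"

definition ell1 :: "(nat \<Rightarrow> 'a::real_normed_vector) set"
  where "ell1 = {a. summable (\<lambda>n. norm (a n))}"

text \<open>The infimum is taken in \<open>enat\<close>, so that it is \<open>\<infinity>\<close> for the empty set.\<close>

definition growth_order :: "(nat \<Rightarrow> real) \<Rightarrow> enat"
  where "growth_order a = Inf {enat m | m. bdd_above ((\<lambda>n. a n / real n ^ m) ` {1..})}"

definition s_means :: "(nat \<Rightarrow> real) \<Rightarrow> ('a::real_normed_vector \<Rightarrow>\<^sub>L 'a) \<Rightarrow> nat \<Rightarrow> ('a \<Rightarrow>\<^sub>L 'a)"
  where "s_means s T n = (1 / s n) *\<^sub>R (\<Sum>k=0..n. Delta s (n - k) *\<^sub>R blinfun_power T k)"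

end

theory Submission
  imports Defs
begin

text \<open>
  Put \<open>D = I - T\<close> and let \<open>W\<^sub>j(n) = \<Sum>\<^sub>k (\<Delta>\<^sup>j s)(n - k) T\<^sup>k\<close>, so that the means in question are
  \<open>A\<^sub>n = W\<^sub>1(n) / s(n)\<close>. Everything rests on the identity
  \<open>D W\<^sub>j(n) = (\<Delta>\<^sup>j s)(n + 1) I - W\<^sub>j\<^sub>+\<^sub>1(n + 1)\<close>. For \<open>j \<ge> 1\<close> it yields
  \<open>D\<^sup>q\<^sup>-\<^sup>1 A\<^sub>n \<longlonglongrightarrow> 0\<close>; for \<open>j = 0\<close> it shows that \<open>I - A\<^sub>n\<^sub>+\<^sub>1\<close> is a multiple of \<open>D W\<^sub>0(n)\<close>.

  If \<open>A\<^sub>n \<longlonglongrightarrow> P\<close>, then \<open>D\<^sup>q\<^sup>-\<^sup>1 P = 0\<close>, and since convergence of the means forces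
  \<open>ker D\<^sup>2 = ker D\<close>, even \<open>D P = 0\<close>. For large \<open>n\<close> the operator \<open>I - A\<^sub>n + P\<close> is invertible, whence
  \<open>ker P\<close> is contained in the range of \<open>D\<close>. Conversely, if \<open>X\<close> is the direct sum of kernel and range of
  \<open>D\<close>, the open mapping theorem provides the bounded projection \<open>P\<close> and a bounded \<open>S\<close> with
  \<open>D S = S D = I - P\<close> and \<open>P S = S P = 0\<close>. Then \<open>P / (z - 1) + (I + (z - 1) S)\<^sup>-\<^sup>1 S\<close> is the resolvent
  near \<open>1\<close>, and \<open>A\<^sub>n - P = S\<^sup>q\<^sup>-\<^sup>1 D\<^sup>q\<^sup>-\<^sup>1 A\<^sub>n \<longlonglongrightarrow> 0\<close>. Finally, comparing Laurent coefficients in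
  \<open>(z - T) R(z) = R(z) (z - T) = I\<close> at a simple pole recovers the decomposition of \<open>X\<close>.
\<close>

section \<open>Complex-linear operators and the Neumann series\<close>

lemma bounded_bilinear_scaleC: "bounded_bilinear (scaleC :: complex \<Rightarrow> 'a::complex_banach \<Rightarrow> 'a)"
proof
  fix r :: real and a a' :: complex and b b' :: 'a
  show "(a + a') *\<^sub>C b = a *\<^sub>C b + a' *\<^sub>C b" "a *\<^sub>C (b + b') = a *\<^sub>C b + a *\<^sub>C b'"
    by (rule scaleC_add_left scaleC_add_right)+
  show "(r *\<^sub>R a) *\<^sub>C b = r *\<^sub>R (a *\<^sub>C b)" "a *\<^sub>C (r *\<^sub>R b) = r *\<^sub>R (a *\<^sub>C b)"
    unfolding scaleR_conv_of_real scaleR_scaleC[of r "_ :: 'a"] by (simp_all add: scaleC_scaleC mult.commute)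
  show "\<exists>K. \<forall>a b. norm (a *\<^sub>C b :: 'a) \<le> norm a * norm b * K"
    by (intro exI[of _ 1]) (simp add: norm_scaleC)
qed

interpretation scaleC: bounded_bilinear "scaleC :: complex \<Rightarrow> 'a::complex_banach \<Rightarrow> 'a"
  by (rule bounded_bilinear_scaleC)

interpretation blinfun_compose: bounded_bilinear "(o\<^sub>L)"
  by (rule bounded_bilinear_blinfun_compose)

lemma scaleC_one [simp]: "1 *\<^sub>C (x::'a::complex_banach) = x"
  using scaleR_scaleC[of 1 x] by simp

lemma L_opsD: "A \<in> L_ops \<Longrightarrow> blinfun_apply A (c *\<^sub>C x) = c *\<^sub>C blinfun_apply A x"
  by (simp add: L_ops_def)

lemma L_ops_closed:
  "id_blinfun \<in> L_ops"
  "A \<in> L_ops \<Longrightarrow> B \<in> L_ops \<Longrightarrow> A + B \<in> L_ops"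
  "A \<in> L_ops \<Longrightarrow> B \<in> L_ops \<Longrightarrow> A - B \<in> L_ops"
  "A \<in> L_ops \<Longrightarrow> B \<in> L_ops \<Longrightarrow> A o\<^sub>L B \<in> L_ops"
  "A \<in> L_ops \<Longrightarrow> z *\<^sub>C A \<in> L_ops"
  by (auto simp: L_ops_def blinfun.bilinear_simps scaleC.add_right scaleC.diff_right
      scaleC_blinfun.rep_eq scaleC_scaleC mult.commute)

lemma blinfun_compose_assoc: "(A o\<^sub>L B) o\<^sub>L C = A o\<^sub>L (B o\<^sub>L C)"
  by (rule blinfun_eqI) simp

lemma blinfun_compose_id [simp]: "id_blinfun o\<^sub>L A = A" "A o\<^sub>L id_blinfun = A"
  by (rule blinfun_eqI, simp)+

text \<open>Neumann series are summed among the real-linear operators. This lemma recovers complex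
  linearity of the resulting inverse from that of \<open>A\<close>.\<close>

lemma L_ops_inverse:
  assumes "A \<in> L_ops" "S o\<^sub>L A = id_blinfun" "A o\<^sub>L S = id_blinfun"
  shows "S \<in> L_ops"
proof -
  have SA: "blinfun_apply S (blinfun_apply A x) = x" and AS: "blinfun_apply A (blinfun_apply S x) = x" for x
    using assms(2,3) by (metis blinfun_apply_blinfun_compose blinfun_apply_id_blinfun id_apply)+
  have "blinfun_apply S (c *\<^sub>C x) = c *\<^sub>C blinfun_apply S x" for c x
    using SA[of "c *\<^sub>C blinfun_apply S x"] by (simp add: L_opsD[OF assms(1)] AS)
  then show ?thesis by (simp add: L_ops_def)
qed

lemma is_inverse_op_unique:
  assumes "is_inverse_op A S" "is_inverse_op A S'"
  shows "S = S'"
  using assms unfolding is_inverse_op_def by (metis blinfun_compose_assoc blinfun_compose_id)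

lemma resolvent_eqI: "is_inverse_op (z *\<^sub>C id_blinfun - T) S \<Longrightarrow> resolvent T z = S"
  unfolding resolvent_def using is_inverse_op_unique by (intro the_equality) auto

lemma is_inverse_op_resolvent:
  "z \<in> resolvent_set T \<Longrightarrow> is_inverse_op (z *\<^sub>C id_blinfun - T) (resolvent T z)"
  unfolding resolvent_set_def using resolvent_eqI by force

lemma scaleC_blinfun_compose:
  "(z *\<^sub>C A) o\<^sub>L B = z *\<^sub>C (A o\<^sub>L B)"
  "A \<in> L_ops \<Longrightarrow> A o\<^sub>L (z *\<^sub>C B) = z *\<^sub>C (A o\<^sub>L B)"
  by (rule blinfun_eqI, simp add: scaleC_blinfun.rep_eq L_opsD)+

lemma blinfun_power_simps [simp]:
  "blinfun_power T 0 = id_blinfun"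
  "blinfun_power T (Suc n) = T o\<^sub>L blinfun_power T n"
  by (simp_all add: blinfun_power_def)

lemma blinfun_power_commutes:
  assumes "A o\<^sub>L T = T o\<^sub>L A"
  shows "A o\<^sub>L blinfun_power T n = blinfun_power T n o\<^sub>L A"
proof (induction n)
  case (Suc n)
  then show ?case using assms by (simp flip: blinfun_compose_assoc) (simp add: blinfun_compose_assoc)
qed simp

lemma norm_blinfun_power_le: "norm (blinfun_power T n) \<le> norm T ^ n"
proof (induction n)
  case 0
  then show ?case by (simp add: norm_blinfun_id_le)
next
  case (Suc n)
  then show ?case
    by simp (meson norm_blinfun_compose mult_left_mono norm_ge_zero order_trans)
qed

lemma blinfun_power_scaleC:
  assumes "T \<in> L_ops"
  shows "blinfun_power (z *\<^sub>C T) n = z ^ n *\<^sub>C blinfun_power T n"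
proof (induction n)
  case (Suc n)
  show ?case
    by (rule blinfun_eqI) (simp add: Suc scaleC_blinfun.rep_eq L_opsD[OF assms] scaleC_scaleC)
qed simp

text \<open>Absolute summability of the powers, rather than \<open>norm E < 1\<close>, is assumed so
  that \<open>E = T / z\<close> is covered for powers of \<open>T\<close> of polynomial growth and
  \<open>cmod z > 1\<close>. The series itself is kept as a conclusion because Laurent coefficients
  are read off from it.\<close>

lemma neumann_series:
  fixes E :: "'a::banach \<Rightarrow>\<^sub>L 'a"
  assumes "summable (\<lambda>n. norm (blinfun_power E n))"
  obtains V where "V o\<^sub>L (id_blinfun - E) = id_blinfun" "(id_blinfun - E) o\<^sub>L V = id_blinfun"
    "blinfun_power E sums V"
proof -
  define V where "V = suminf (blinfun_power E)"
  have V: "blinfun_power E sums V"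
    unfolding V_def using summable_norm_cancel[OF assms] by (rule summable_sums)
  have shift: "(\<lambda>n. blinfun_power E (Suc n)) sums (V - id_blinfun)"
    using V by (subst sums_Suc_iff) simp
  have "(\<lambda>n. blinfun_power E (Suc n)) sums (E o\<^sub>L V)"
    using bounded_linear.sums[OF blinfun_compose.bounded_linear_right[of E] V] by simp
  with shift have EV: "E o\<^sub>L V = V - id_blinfun" by (metis sums_unique2)
  have "(\<lambda>n. blinfun_power E (Suc n)) sums (V o\<^sub>L E)"
    using bounded_linear.sums[OF blinfun_compose.bounded_linear_left[of E] V]
    by (simp add: blinfun_power_commutes)
  with shift have VE: "V o\<^sub>L E = V - id_blinfun" by (metis sums_unique2)
  show ?thesis
    by (rule that[of V]) (simp_all add: EV VE V blinfun_compose.diff_left blinfun_compose.diff_right)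
qed

lemma neumann_series_norm_less_1:
  fixes E :: "'a::banach \<Rightarrow>\<^sub>L 'a"
  assumes "norm E < 1"
  obtains V where "V o\<^sub>L (id_blinfun - E) = id_blinfun" "(id_blinfun - E) o\<^sub>L V = id_blinfun"
    "blinfun_power E sums V"
proof (rule neumann_series)
  show "summable (\<lambda>n. norm (blinfun_power E n))"
    using assms by (intro summable_comparison_test'[OF summable_geometric[of "norm E"]])
      (auto simp: norm_blinfun_power_le)
qed (rule that)

section \<open>Operators whose kernel and range are complementary\<close>

text \<open>The open mapping theorem in quantitative form: Baire category gives approximate
  preimages of controlled norm, and iteration on the error makes them exact. The closed subspace
  \<open>S\<close> takes the role of the Banach domain, which is later a kernel times the whole
  space.\<close>

lemma open_mapping_on_subspace:
  fixes f :: "'a::banach \<Rightarrow> 'b::banach"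
  assumes "bounded_linear f" "subspace S" "closed S" "f ` S = UNIV"
  obtains C where "0 \<le> C" "\<And>y. \<exists>x\<in>S. f x = y \<and> norm x \<le> C * norm y"
proof -
  interpret f: bounded_linear f by fact
  define B where "B n = closure (f ` (S \<inter> cball 0 (real n)))" for n
  have UB: "(\<Union>n. B n) = UNIV"
  proof -
    have "y \<in> (\<Union>n. B n)" for y
    proof -
      obtain x where x: "x \<in> S" "f x = y" using assms(4) by (metis imageE UNIV_I)
      obtain n where "norm x \<le> real n" using real_arch_simple by blast
      then have "y \<in> f ` (S \<inter> cball 0 (real n))" using x by auto
      then show ?thesis using closure_subset[of "f ` (S \<inter> cball 0 (real n))"] by (auto simp: B_def)
    qed
    then show ?thesis by auto
  qed
  have "\<exists>n. interior (B n) \<noteq> {}"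
  proof (rule ccontr)
    assume "\<not> ?thesis"
    then have "euclidean interior_of \<Union>(range B) = {}"
      by (intro Baire_category_alt) (auto simp: B_def completely_metrizable_space_euclidean)
    then show False using UB by auto
  qed
  then obtain n y0 where "y0 \<in> interior (B n)" by blast
  then obtain e where e: "0 < e" "cball y0 e \<subseteq> B n"
    by (auto simp: mem_interior_cball)
  define K where "K = 2 * real n / e"
  have K0: "0 \<le> K" using e by (simp add: K_def)
  \<comment> \<open>Both \<open>y0\<close> and \<open>y0 + c y\<close> lie in the ball inside
    \<open>B n\<close>, so images of vectors of norm at most \<open>n\<close> come within
    \<open>e / 4\<close> of them. Dividing the difference of these vectors by
    \<open>c = e / norm y\<close> yields the constant \<open>K\<close> and the error
    \<open>norm y / 2\<close>.\<close>
  have approx: "\<exists>x\<in>S. norm x \<le> K * norm y \<and> norm (y - f x) \<le> norm y / 2" for y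
  proof (cases "y = 0")
    case True
    then show ?thesis using subspace_0[OF assms(2)] by (intro bexI[of _ 0]) (auto simp: f.zero)
  next
    case False
    define c where "c = e / norm y"
    have c: "0 < c" using e False by (simp add: c_def)
    have "y0 \<in> B n" "y0 + c *\<^sub>R y \<in> B n"
      using e False by (auto simp: c_def dist_norm subset_iff)
    moreover have "\<exists>u\<in>S. norm u \<le> n \<and> dist (f u) z < e / 4" if "z \<in> B n" for z
    proof -
      have "\<forall>\<delta>>0. \<exists>w\<in>f ` (S \<inter> cball 0 (real n)). dist w z < \<delta>"
        using that by (simp add: B_def closure_approachable)
      then have "\<exists>w\<in>f ` (S \<inter> cball 0 (real n)). dist w z < e / 4"
        using e(1) by (metis zero_less_divide_iff zero_less_numeral)
      then show ?thesis by auto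
    qed
    ultimately obtain u v where u: "u \<in> S" "norm u \<le> n" "dist (f u) y0 < e / 4"
      and v: "v \<in> S" "norm v \<le> n" "dist (f v) (y0 + c *\<^sub>R y) < e / 4"
      by blast
    let ?x = "(1 / c) *\<^sub>R (v - u)"
    have "?x \<in> S" using u v assms(2) by (intro subspace_scale subspace_diff)
    moreover have "norm ?x \<le> K * norm y"
    proof -
      have "norm (v - u) \<le> 2 * n" using norm_triangle_ineq4[of v u] u v by linarith
      then have "1 / c * norm (v - u) \<le> 1 / c * (2 * n)" using c by (intro mult_left_mono) simp_all
      then show ?thesis using c e(1) by (simp add: K_def c_def mult_ac)
    qed
    moreover have "norm (y - f ?x) \<le> norm y / 2"
    proof -
      have "c *\<^sub>R (y - f ?x) = (f u - y0) - (f v - (y0 + c *\<^sub>R y))"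
        using c by (simp add: f.scaleR f.diff scaleR_diff_right)
      then have "c * norm (y - f ?x) \<le> norm (f u - y0) + norm (f v - (y0 + c *\<^sub>R y))"
        by (metis abs_of_pos c norm_scaleR norm_triangle_ineq4)
      also have "\<dots> \<le> e / 2" using u v by (simp add: dist_norm)
      finally show ?thesis using c e(1) False by (simp add: c_def field_simps)
    qed
    ultimately show ?thesis by blast
  qed
  then obtain g where g: "\<And>y. g y \<in> S" "\<And>y. norm (g y) \<le> K * norm y"
    "\<And>y. norm (y - f (g y)) \<le> norm y / 2" by metis
  show thesis
  proof (rule that[of "2 * K"])
    fix y
    \<comment> \<open>\<open>r k\<close> is the error left after \<open>k\<close> corrections. It is
      halved each time, so the corrections sum to a preimage of norm at most
      \<open>2 * K * norm y\<close>.\<close>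
    define r where "r k = ((\<lambda>y. y - f (g y)) ^^ k) y" for k
    have r0: "r 0 = y" and rS: "r (Suc k) = r k - f (g (r k))" for k by (simp_all add: r_def)
    have nr: "norm (r k) \<le> norm y * (1/2) ^ k" for k
    proof (induction k)
      case (Suc k)
      then show ?case using g(3)[of "r k"] by (simp add: rS)
    qed (simp add: r0)
    have ng: "norm (g (r k)) \<le> K * norm y * (1/2) ^ k" for k
      using g(2)[of "r k"] mult_left_mono[OF nr[of k] K0] by (simp add: mult.assoc)
    have geo: "(\<lambda>k. K * norm y * (1/2) ^ k) sums (K * norm y * 2)"
      using sums_mult[OF geometric_sums[of "1/2::real"]] by simp
    have sn: "summable (\<lambda>k. norm (g (r k)))"
      using ng by (intro summable_comparison_test'[OF sums_summable[OF geo]]) auto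
    have sg: "(\<lambda>k. g (r k)) sums (\<Sum>k. g (r k))"
      by (rule summable_sums[OF summable_norm_cancel[OF sn]])
    let ?x = "\<Sum>k. g (r k)"
    have "(\<Sum>k<m. g (r k)) \<in> S" for m
      by (rule subspace_sum[OF assms(2)]) (rule g(1))
    then have "?x \<in> S"
      by (rule closed_sequentially[OF assms(3) _ sg[unfolded sums_def]])
    moreover have "norm ?x \<le> 2 * K * norm y"
    proof -
      have "norm ?x \<le> (\<Sum>k. norm (g (r k)))" by (rule summable_norm[OF sn])
      also have "\<dots> \<le> (\<Sum>k. K * norm y * (1/2) ^ k)"
        by (intro suminf_le ng sn sums_summable[OF geo])
      also have "\<dots> = 2 * K * norm y" using sums_unique[OF geo] by simp
      finally show ?thesis .
    qed
    moreover have "f ?x = y"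
    proof -
      have r_lim: "r \<longlonglongrightarrow> 0"
      proof (rule Lim_null_comparison[OF always_eventually])
        show "\<forall>k. norm (r k) \<le> norm y * (1/2) ^ k" using nr by blast
        show "(\<lambda>k. norm y * (1/2) ^ k) \<longlonglongrightarrow> 0"
          by (intro tendsto_mult_right_zero LIMSEQ_realpow_zero) auto
      qed
      have "(\<Sum>k<m. f (g (r k))) = y - r m" for m
        by (induction m) (auto simp: r0 rS)
      then have "(\<lambda>k. f (g (r k))) sums y"
        unfolding sums_def using tendsto_diff[OF tendsto_const[of y] r_lim] by simp
      then show ?thesis using f.sums[OF sg] sums_unique2 by blast
    qed
    ultimately show "\<exists>x\<in>S. f x = y \<and> norm x \<le> 2 * K * norm y" by blast
  qed (use K0 in simp)
qed

text \<open>The range of \<open>D\<close> is not assumed closed, so boundedness of the projection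
  comes from the open mapping theorem for \<open>(n, y) \<mapsto> n + D y\<close> on kernel times
  space: every \<open>x\<close> splits with both \<open>n\<close> and \<open>y\<close> bounded by a
  multiple of \<open>norm x\<close>.\<close>

lemma reduced_resolvent_of_direct_sum:
  fixes D :: "'a::complex_banach \<Rightarrow>\<^sub>L 'a"
  assumes D: "D \<in> L_ops" and sum: "direct_sum_decomp (op_kernel D) (op_range D)"
  obtains P S where "P \<in> L_ops" "S \<in> L_ops" "D o\<^sub>L P = 0" "P o\<^sub>L D = 0" "P o\<^sub>L S = 0"
    "S o\<^sub>L P = 0" "D o\<^sub>L S = id_blinfun - P" "S o\<^sub>L D = id_blinfun - P"
proof -
  let ?N = "op_kernel D" and ?R = "op_range D"
  have kerD: "u \<in> ?N \<longleftrightarrow> blinfun_apply D u = 0" for u by (simp add: op_kernel_def)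
  have subN: "subspace ?N" by (auto simp: subspace_def op_kernel_def blinfun.bilinear_simps)
  have subR: "subspace ?R"
    by (intro subspace_UNIV linear_subspace_image bounded_linear.linear blinfun.bounded_linear_right)
  have RC: "c *\<^sub>C u \<in> ?R" if "u \<in> ?R" for c u
    using that L_opsD[OF D, of c] by (metis (no_types) imageE rangeI)
  have NC: "c *\<^sub>C u \<in> ?N" if "u \<in> ?N" for c u
    using that by (simp add: kerD L_opsD[OF D] scaleC.zero_right)
  have NR: "u = 0" if "u \<in> ?N" "u \<in> ?R" for u
    using sum that by (auto simp: direct_sum_decomp_def)
  have closedN: "closed ?N"
    unfolding op_kernel_def
    by (intro closed_Collect_eq continuous_intros linear_continuous_on blinfun.bounded_linear_right)
  define f where "f = (\<lambda>(n, y). n + blinfun_apply D y)"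
  have "bounded_linear f"
    unfolding f_def case_prod_beta
    by (intro bounded_linear_add bounded_linear_fst
        bounded_linear_compose[OF blinfun.bounded_linear_right bounded_linear_snd])
  moreover have "subspace (?N \<times> UNIV)" by (intro subspace_Times subN subspace_UNIV)
  moreover have "closed (?N \<times> UNIV)" by (intro closed_Times closedN closed_UNIV)
  moreover have "f ` (?N \<times> UNIV) = UNIV"
    using sum by (force simp: direct_sum_decomp_def f_def image_iff set_eq_iff)
  ultimately obtain C where C: "0 \<le> C"
    "\<And>x. \<exists>u\<in>?N \<times> UNIV. f u = x \<and> norm u \<le> C * norm x"
    by (rule open_mapping_on_subspace) blast
  have "\<exists>n y. n \<in> ?N \<and> x = n + blinfun_apply D y \<and> norm n \<le> C * norm x \<and> norm y \<le> C * norm x" for x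
  proof -
    obtain n y where "n \<in> ?N" "n + blinfun_apply D y = x" "norm (n, y) \<le> C * norm x"
      using C(2)[of x] by (auto simp: f_def)
    moreover have "norm n \<le> norm (n, y)" "norm y \<le> norm (n, y)"
      by (metis fst_conv norm_fst_le, metis snd_conv norm_snd_le)
    ultimately show ?thesis by (metis order_trans)
  qed
  then obtain p y where p: "\<And>x. p x \<in> ?N" "\<And>x. x = p x + blinfun_apply D (y x)"
    "\<And>x. norm (p x) \<le> C * norm x" "\<And>x. norm (y x) \<le> C * norm x"
    by metis
  have pR: "x - p x \<in> ?R" for x by (metis add_diff_cancel_left' p(2) rangeI)
  \<comment> \<open>The values \<open>p x\<close> and \<open>y x\<close> are arbitrary choices.
    Linearity of \<open>p\<close> rests on the uniqueness of the splitting.\<close>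
  have p_unique: "u = p x" if "u \<in> ?N" "x - u \<in> ?R" for u x
  proof -
    have "u - p x \<in> ?N" using subN that p(1) by (intro subspace_diff)
    moreover have "(x - p x) - (x - u) \<in> ?R"
      by (rule subspace_diff[OF subR pR that(2)])
    ultimately have "u - p x = 0" by (intro NR) simp_all
    then show ?thesis by simp
  qed
  have "bounded_linear p"
  proof (rule bounded_linear_intro[where K = C])
    fix u v r
    show "p (u + v) = p u + p v"
      using subspace_add[OF subR pR[of u] pR[of v]]
      by (intro p_unique[symmetric] subspace_add[OF subN] p(1)) (simp add: algebra_simps)
    show "p (r *\<^sub>R u) = r *\<^sub>R p u"
      using subspace_scale[OF subR pR[of u], of r]
      by (intro p_unique[symmetric] subspace_scale[OF subN] p(1)) (simp add: algebra_simps)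
    show "norm (p u) \<le> norm u * C" using p(3)[of u] by (simp add: mult.commute)
  qed
  then interpret p: bounded_linear p .
  have pC: "p (c *\<^sub>C u) = c *\<^sub>C p u" for c u
    using RC[OF pR[of u], of c]
    by (intro p_unique[symmetric] NC p(1)) (simp add: scaleC.diff_right)
  \<comment> \<open>Removing the kernel part moves the chosen preimage \<open>y x\<close> into the
    range without changing its image under \<open>D\<close>. There the preimage is unique, which
    makes \<open>s\<close> linear.\<close>
  define s where "s x = y x - p (y x)" for x
  have Dp: "blinfun_apply D (p x) = 0" for x using p(1) kerD by blast
  have sR: "s x \<in> ?R" for x unfolding s_def by (rule pR)
  have Ds: "blinfun_apply D (s x) = x - p x" for x
    using p(2)[of x] by (simp add: s_def blinfun.bilinear_simps Dp algebra_simps)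
  have s_unique: "u = s x" if "u \<in> ?R" "blinfun_apply D u = x - p x" for u x
  proof -
    have "u - s x \<in> ?R" using subR that(1) sR by (rule subspace_diff)
    moreover have "u - s x \<in> ?N" using that(2) by (simp add: kerD blinfun.bilinear_simps Ds)
    ultimately show ?thesis using NR by fastforce
  qed
  have "bounded_linear s"
  proof (rule bounded_linear_intro[where K = "C + C * C"])
    fix u v r
    show "s (u + v) = s u + s v"
      using subspace_add[OF subR sR[of u] sR[of v]]
      by (intro s_unique[symmetric]) (simp_all add: blinfun.bilinear_simps Ds p.add)
    show "s (r *\<^sub>R u) = r *\<^sub>R s u"
      using subspace_scale[OF subR sR[of u], of r]
      by (intro s_unique[symmetric]) (simp_all add: blinfun.bilinear_simps Ds p.scaleR algebra_simps)
    have "norm (s u) \<le> norm (y u) + norm (p (y u))" unfolding s_def by (rule norm_triangle_ineq4)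
    also have "\<dots> \<le> norm (y u) + C * norm (y u)" using p(3) by simp
    also have "\<dots> \<le> C * norm u + C * (C * norm u)" using p(4)[of u] C(1) by (intro add_mono mult_left_mono)
    finally show "norm (s u) \<le> norm u * (C + C * C)" by (simp add: algebra_simps)
  qed
  then interpret s: bounded_linear s .
  have sC: "s (c *\<^sub>C u) = c *\<^sub>C s u" for c u
    using RC[OF sR[of u], of c]
    by (intro s_unique[symmetric]) (simp_all add: L_opsD[OF D] Ds pC scaleC.diff_right)
  have pD: "p (blinfun_apply D x) = 0" for x
    by (rule p_unique[symmetric]) (simp_all add: kerD blinfun.zero_right)
  have pp: "p (p x) = p x" for x
    by (rule p_unique[symmetric]) (use p(1) subspace_0[OF subR] in simp_all)
  note bl [simp] = bounded_linear_Blinfun_apply[OF p.bounded_linear_axioms]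
    bounded_linear_Blinfun_apply[OF s.bounded_linear_axioms]
  show thesis
  proof (rule that[of "Blinfun p" "Blinfun s"])
    show "Blinfun p \<in> L_ops" "Blinfun s \<in> L_ops" by (simp_all add: L_ops_def pC sC)
    show "D o\<^sub>L Blinfun p = 0" "Blinfun p o\<^sub>L D = 0"
      by (rule blinfun_eqI, simp add: Dp pD)+
    show "Blinfun p o\<^sub>L Blinfun s = 0"
      by (rule blinfun_eqI) (simp add: s_def p.diff pp)
    show "Blinfun s o\<^sub>L Blinfun p = 0"
      using subspace_0[OF subR]
      by (intro blinfun_eqI) (simp, intro s_unique[symmetric], simp_all add: pp blinfun.zero_right)
    show "D o\<^sub>L Blinfun s = id_blinfun - Blinfun p"
      by (rule blinfun_eqI) (simp add: Ds blinfun.bilinear_simps)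
    show "Blinfun s o\<^sub>L D = id_blinfun - Blinfun p"
      by (rule blinfun_eqI, simp add: blinfun.bilinear_simps, rule s_unique[symmetric])
        (simp_all add: pR blinfun.bilinear_simps Dp pD)
  qed
qed

text \<open>Common end of two arguments, with \<open>P\<close> the residue at a pole or the limit of
  the means. \<open>P o\<^sub>L D = 0\<close> and the decomposition of the identity give
  \<open>op_range D = op_kernel P\<close>, so the range is closed as the kernel of a bounded
  operator.\<close>

lemma direct_sum_of_projection:
  assumes "D o\<^sub>L P = 0" "P o\<^sub>L D = 0" "id_blinfun = P + (D o\<^sub>L S)"
    and "\<And>x. blinfun_apply D x = 0 \<Longrightarrow> blinfun_apply P x = x"
  shows "direct_sum_decomp (op_kernel D) (op_range D)"
    and "op_range D = op_kernel P"
    and "closed (op_range D)"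
    and "P \<in> L_ops \<Longrightarrow> is_projection P (op_kernel D) (op_range D)"
proof -
  have DP: "blinfun_apply D (blinfun_apply P x) = 0" and PD: "blinfun_apply P (blinfun_apply D x) = 0"
    and dec: "x = blinfun_apply P x + blinfun_apply D (blinfun_apply S x)" for x
    using arg_cong[OF assms(1), of "\<lambda>A. blinfun_apply A x"]
      arg_cong[OF assms(2), of "\<lambda>A. blinfun_apply A x"]
      arg_cong[OF assms(3), of "\<lambda>A. blinfun_apply A x"]
    by (simp_all add: blinfun.bilinear_simps)
  have closed_ker: "closed (op_kernel A)" for A :: "'a \<Rightarrow>\<^sub>L 'a"
    unfolding op_kernel_def
    by (intro closed_Collect_eq continuous_intros linear_continuous_on blinfun.bounded_linear_right)
  show R: "op_range D = op_kernel P"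
  proof
    show "op_kernel P \<subseteq> op_range D"
      unfolding op_kernel_def using dec by (metis (mono_tags, lifting) add_0 mem_Collect_eq rangeI subsetI)
  qed (auto simp: op_kernel_def PD)
  show closedR: "closed (op_range D)" unfolding R by (rule closed_ker)
  show ds: "direct_sum_decomp (op_kernel D) (op_range D)"
    unfolding direct_sum_decomp_def
  proof
    have "\<exists>y z. x = y + z \<and> y \<in> op_kernel D \<and> z \<in> op_range D" for x
      using dec[of x] DP[of x] by (force simp: op_kernel_def)
    then show "{y + z |y z. y \<in> op_kernel D \<and> z \<in> op_range D} = UNIV" by auto
    show "op_kernel D \<inter> op_range D = {0}"
      using assms(4) unfolding R by (auto simp: op_kernel_def blinfun.zero_right)
  qed
  show "is_projection P (op_kernel D) (op_range D)" if "P \<in> L_ops"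
  proof -
    have "blinfun_apply P x \<in> op_kernel D" "x - blinfun_apply P x \<in> op_range D" for x
      using DP dec by (auto simp: op_kernel_def) (metis add_diff_cancel_left' rangeI)
    then show ?thesis using that ds closedR closed_ker by (auto simp: is_projection_def)
  qed
qed

section \<open>Simple poles of the resolvent\<close>

text \<open>The expansion is given only off the centre. Convergence at radius \<open>r / 2\<close>
  bounds the coefficients geometrically, and the terms after the first are then dominated by a
  geometric series of ratio \<open>cmod h / \<rho>\<close>. Laurent coefficients thereby become
  limits.\<close>

lemma powser_sums_tendsto_0:
  fixes c :: "nat \<Rightarrow> 'a::complex_banach"
  assumes r: "0 < r"
    and G: "\<And>h. 0 < cmod h \<Longrightarrow> cmod h < r \<Longrightarrow> (\<lambda>n. h ^ n *\<^sub>C c n) sums G h"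
  shows "(G \<longlongrightarrow> c 0) (at 0)"
proof -
  define \<rho> where "\<rho> = r / 2"
  have \<rho>: "0 < \<rho>" "\<rho> < r" using r by (simp_all add: \<rho>_def)
  have "(\<lambda>n. complex_of_real \<rho> ^ n *\<^sub>C c n) sums G \<rho>" using \<rho> by (intro G) simp_all
  then have "Bseq (\<lambda>n. complex_of_real \<rho> ^ n *\<^sub>C c n)"
    by (intro convergent_imp_Bseq convergentI[OF summable_LIMSEQ_zero] sums_summable)
  then obtain M where M: "0 < M" "\<And>n. norm (complex_of_real \<rho> ^ n *\<^sub>C c n) \<le> M"
    by (auto simp: Bseq_def)
  have M': "norm (c n) \<le> M / \<rho> ^ n" for n
    using M(2)[of n] \<rho> by (simp add: norm_scaleC norm_power field_simps)
  have bound: "norm (G h - c 0) \<le> M * (cmod h / \<rho>) / (1 - cmod h / \<rho>)" if h: "h \<noteq> 0" "cmod h < \<rho>" for h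
  proof -
    define t where "t = cmod h / \<rho>"
    have t: "0 < t" "t < 1" using h \<rho> by (simp_all add: t_def)
    have sh: "(\<lambda>n. h ^ Suc n *\<^sub>C c (Suc n)) sums (G h - c 0)"
      using G[of h] h \<rho> by (subst sums_Suc_iff) simp
    have geo: "(\<lambda>n. M * t * t ^ n) sums (M * t * (1 / (1 - t)))"
      using t by (intro sums_mult geometric_sums) simp
    have le: "norm (h ^ Suc n *\<^sub>C c (Suc n)) \<le> M * t * t ^ n" for n
    proof -
      have "norm (h ^ Suc n *\<^sub>C c (Suc n)) \<le> cmod h ^ Suc n * (M / \<rho> ^ Suc n)"
        unfolding norm_scaleC norm_power by (intro mult_left_mono M') simp
      also have "\<dots> = M * t * t ^ n" by (simp add: t_def power_divide)
      finally show ?thesis .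
    qed
    have sn: "summable (\<lambda>n. norm (h ^ Suc n *\<^sub>C c (Suc n)))"
      using le by (intro summable_comparison_test'[OF sums_summable[OF geo]]) auto
    have "norm (G h - c 0) \<le> (\<Sum>n. norm (h ^ Suc n *\<^sub>C c (Suc n)))"
      using summable_norm[OF sn] sums_unique[OF sh] by simp
    also have "\<dots> \<le> (\<Sum>n. M * t * t ^ n)" by (intro suminf_le le sn sums_summable[OF geo])
    also have "\<dots> = M * t / (1 - t)" using sums_unique[OF geo] by simp
    finally show ?thesis by (simp add: t_def)
  qed
  have "((\<lambda>h. G h - c 0) \<longlongrightarrow> 0) (at 0)"
  proof (rule Lim_null_comparison)
    show "\<forall>\<^sub>F h in at 0. norm (G h - c 0) \<le> M * (cmod h / \<rho>) / (1 - cmod h / \<rho>)"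
      unfolding eventually_at using bound \<rho>(1) by (intro exI[of _ \<rho>]) auto
    have "((\<lambda>h. M * (cmod h / \<rho>) / (1 - cmod h / \<rho>)) \<longlongrightarrow> M * (cmod 0 / \<rho>) / (1 - cmod 0 / \<rho>)) (at 0)"
      using \<rho> by (intro tendsto_intros) auto
    then show "((\<lambda>h. M * (cmod h / \<rho>) / (1 - cmod h / \<rho>)) \<longlongrightarrow> 0) (at 0)" by simp
  qed
  then show ?thesis by (rule LIM_zero_cancel)
qed

lemma simple_pole_imp_direct_sum:
  fixes T :: "'a::complex_banach \<Rightarrow>\<^sub>L 'a"
  assumes T: "T \<in> L_ops" and pole: "simple_pole (resolvent T) (resolvent_set T) 1"
  shows "direct_sum_decomp (op_kernel (id_blinfun - T)) (op_range (id_blinfun - T))"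
proof -
  define D where "D = id_blinfun - T"
  have D: "D \<in> L_ops" unfolding D_def by (intro L_ops_closed T)
  obtain r c where r: "0 < r" and rc: "\<And>z. 0 < cmod (z - 1) \<Longrightarrow> cmod (z - 1) < r \<Longrightarrow>
      z \<in> resolvent_set T \<and> (\<lambda>n. (z - 1) powi (int n - 1) *\<^sub>C c (int n - 1)) sums resolvent T z"
    using pole unfolding pole_of_order_def by auto
  \<comment> \<open>Multiplication by \<open>h\<close> removes the pole, so \<open>F\<close> tends
    to the residue \<open>c (-1)\<close>, the future projection. Below, \<open>G\<close> is the
    resolvent without its principal part and tends to \<open>c 0\<close>.\<close>
  define F where "F h = h *\<^sub>C resolvent T (1 + h)" for h
  have F_sums: "(\<lambda>n. h ^ n *\<^sub>C c (int n - 1)) sums F h" if "0 < cmod h" "cmod h < r" for h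
  proof -
    have "h * h powi (int n - 1) = h ^ n" for n
      using that(1) power_int_add_1'[of h "int n - 1"] by simp
    moreover have "(\<lambda>n. h *\<^sub>C (h powi (int n - 1) *\<^sub>C c (int n - 1))) sums F h"
      unfolding F_def using rc[of "1 + h"] that by (intro bounded_linear.sums[OF bounded_linear_scaleC_right]) auto
    ultimately show ?thesis by (simp add: scaleC_scaleC)
  qed
  have F_lim: "(F \<longlongrightarrow> c (-1)) (at 0)"
    using powser_sums_tendsto_0[OF r F_sums] by simp
  define G where "G h = resolvent T (1 + h) - (1 / h) *\<^sub>C c (-1)" for h
  have G_lim: "(G \<longlongrightarrow> c 0) (at 0)"
  proof -
    have "(\<lambda>n. h ^ n *\<^sub>C c (int n)) sums G h" if "0 < cmod h" "cmod h < r" for h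
    proof -
      have "(\<lambda>n. h powi (int n - 1) *\<^sub>C c (int n - 1)) sums resolvent T (1 + h)"
        using rc[of "1 + h"] that by simp
      then have "(\<lambda>n. h powi (int (Suc n) - 1) *\<^sub>C c (int (Suc n) - 1)) sums G h"
        unfolding G_def by (subst sums_Suc_iff) (simp add: power_int_minus inverse_eq_divide)
      then show ?thesis by simp
    qed
    then show ?thesis using powser_sums_tendsto_0[OF r, of "\<lambda>n. c (int n)"] by simp
  qed
  have inv: "(h *\<^sub>C id_blinfun + D) o\<^sub>L resolvent T (1 + h) = id_blinfun"
      "resolvent T (1 + h) o\<^sub>L (h *\<^sub>C id_blinfun + D) = id_blinfun"
      "resolvent T (1 + h) \<in> L_ops"
    if "0 < cmod h" "cmod h < r" for h
    using is_inverse_op_resolvent[of "1 + h" T] rc[of "1 + h"] that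
    by (simp_all add: is_inverse_op_def D_def scaleC.add_left algebra_simps)
  have ev: "eventually (\<lambda>h. 0 < cmod h \<and> cmod h < r) (at 0)"
    unfolding eventually_at using r by (intro exI[of _ r]) auto
  define P where "P = c (-1)"
  \<comment> \<open>Both lines rearrange \<open>(h + D) R = R (h + D) = I\<close> multiplied by
    \<open>h\<close>. The right-hand sides vanish as \<open>h\<close> tends to \<open>0\<close>, so
    the residue is annihilated by \<open>D\<close> on either side.\<close>
  have hF: "D o\<^sub>L F h = h *\<^sub>C (id_blinfun - F h)" "F h o\<^sub>L D = h *\<^sub>C (id_blinfun - F h)"
    if "0 < cmod h" "cmod h < r" for h
  proof -
    have "h *\<^sub>C resolvent T (1 + h) + (D o\<^sub>L resolvent T (1 + h)) = id_blinfun"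
      using inv(1)[OF that] by (simp add: blinfun_compose.add_left scaleC_blinfun_compose)
    then have "h *\<^sub>C (D o\<^sub>L resolvent T (1 + h)) = h *\<^sub>C (id_blinfun - F h)"
      unfolding F_def by (metis add_diff_cancel_left')
    then show "D o\<^sub>L F h = h *\<^sub>C (id_blinfun - F h)"
      unfolding F_def by (simp add: scaleC_blinfun_compose D)
    have "h *\<^sub>C resolvent T (1 + h) + (resolvent T (1 + h) o\<^sub>L D) = id_blinfun"
      using inv(2,3)[OF that] by (simp add: blinfun_compose.add_right scaleC_blinfun_compose)
    then have "h *\<^sub>C (resolvent T (1 + h) o\<^sub>L D) = h *\<^sub>C (id_blinfun - F h)"
      unfolding F_def by (metis add_diff_cancel_left')
    then show "F h o\<^sub>L D = h *\<^sub>C (id_blinfun - F h)"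
      unfolding F_def by (simp add: scaleC_blinfun_compose)
  qed
  have lim0: "((\<lambda>h. h *\<^sub>C (id_blinfun - F h)) \<longlongrightarrow> 0) (at 0)"
    using scaleC.tendsto[OF tendsto_ident_at tendsto_diff[OF tendsto_const F_lim]]
    by (simp add: scaleC.zero_left)
  have DP: "D o\<^sub>L P = 0"
  proof (rule tendsto_unique[OF _ _ lim0])
    have "((\<lambda>h. D o\<^sub>L F h) \<longlongrightarrow> D o\<^sub>L P) (at 0)"
      unfolding P_def by (intro blinfun_compose.tendsto tendsto_const F_lim)
    then show "((\<lambda>h. h *\<^sub>C (id_blinfun - F h)) \<longlongrightarrow> D o\<^sub>L P) (at 0)"
      by (rule Lim_transform_eventually) (rule eventually_mono[OF ev], simp add: hF(1))
  qed simp
  have PD: "P o\<^sub>L D = 0"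
  proof (rule tendsto_unique[OF _ _ lim0])
    have "((\<lambda>h. F h o\<^sub>L D) \<longlongrightarrow> P o\<^sub>L D) (at 0)"
      unfolding P_def by (intro blinfun_compose.tendsto tendsto_const F_lim)
    then show "((\<lambda>h. h *\<^sub>C (id_blinfun - F h)) \<longlongrightarrow> P o\<^sub>L D) (at 0)"
      by (rule Lim_transform_eventually) (rule eventually_mono[OF ev], simp add: hF(2))
  qed simp
  \<comment> \<open>Since \<open>D o\<^sub>L P = 0\<close>, replacing the resolvent by
    \<open>G\<close> leaves \<open>D o\<^sub>L R\<close> unchanged. The sum is therefore exactly the
    identity near \<open>0\<close>, and its limit is the constant Laurent coefficient of the
    resolvent equation.\<close>
  have id1: "id_blinfun = P + (D o\<^sub>L c 0)"
  proof (rule tendsto_unique)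
    show "((\<lambda>h. F h + (D o\<^sub>L G h)) \<longlongrightarrow> P + (D o\<^sub>L c 0)) (at 0)"
      unfolding P_def by (intro tendsto_add blinfun_compose.tendsto tendsto_const F_lim G_lim)
    show "((\<lambda>h. F h + (D o\<^sub>L G h)) \<longlongrightarrow> id_blinfun) (at 0)"
    proof (rule tendsto_eventually, rule eventually_mono[OF ev])
      fix h assume h: "0 < cmod h \<and> cmod h < r"
      have "F h + (D o\<^sub>L resolvent T (1 + h)) = id_blinfun"
        unfolding F_def using inv(1)[of h] h
        by (simp add: blinfun_compose.add_left scaleC_blinfun_compose)
      then show "F h + (D o\<^sub>L G h) = id_blinfun"
        unfolding G_def using DP
        by (simp add: blinfun_compose.diff_right scaleC_blinfun_compose D P_def scaleC.zero_right)
    qed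
  qed simp
  have id2: "id_blinfun = P + (c 0 o\<^sub>L D)"
  proof (rule tendsto_unique)
    show "((\<lambda>h. F h + (G h o\<^sub>L D)) \<longlongrightarrow> P + (c 0 o\<^sub>L D)) (at 0)"
      unfolding P_def by (intro tendsto_add blinfun_compose.tendsto tendsto_const F_lim G_lim)
    show "((\<lambda>h. F h + (G h o\<^sub>L D)) \<longlongrightarrow> id_blinfun) (at 0)"
    proof (rule tendsto_eventually, rule eventually_mono[OF ev])
      fix h assume h: "0 < cmod h \<and> cmod h < r"
      have "F h + (resolvent T (1 + h) o\<^sub>L D) = id_blinfun"
        unfolding F_def using inv(2,3)[of h] h
        by (simp add: blinfun_compose.add_right scaleC_blinfun_compose)
      then show "F h + (G h o\<^sub>L D) = id_blinfun"
        unfolding G_def using PD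
        by (simp add: blinfun_compose.diff_left scaleC_blinfun_compose P_def scaleC.zero_right)
    qed
  qed simp
  have "blinfun_apply P x = x" if "blinfun_apply D x = 0" for x
    using arg_cong[OF id2, of "\<lambda>A. blinfun_apply A x"] that
    by (simp add: blinfun.bilinear_simps)
  then show ?thesis
    using direct_sum_of_projection(1)[OF DP PD id1] by (simp add: D_def)
qed

lemma direct_sum_of_resolvent_set:
  assumes "1 \<in> resolvent_set T"
  shows "direct_sum_decomp (op_kernel (id_blinfun - T)) (op_range (id_blinfun - T))"
proof -
  obtain S where "S o\<^sub>L (id_blinfun - T) = id_blinfun" "(id_blinfun - T) o\<^sub>L S = id_blinfun"
    using assms by (auto simp: resolvent_set_def is_inverse_op_def)
  then have SD: "blinfun_apply S (blinfun_apply (id_blinfun - T) x) = x"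
    and DS: "blinfun_apply (id_blinfun - T) (blinfun_apply S x) = x" for x
    by (metis blinfun_apply_blinfun_compose blinfun_apply_id_blinfun)+
  have "op_kernel (id_blinfun - T) = {0}"
    unfolding op_kernel_def using SD by (auto simp: blinfun.zero_right) (metis SD blinfun.zero_right)
  moreover have "op_range (id_blinfun - T) = UNIV" using DS by (metis surjI)
  ultimately show ?thesis by (simp add: direct_sum_decomp_def)
qed

text \<open>With \<open>h = z - 1\<close>, the operator \<open>h + D\<close> is multiplication by
  \<open>h\<close> on the range of \<open>P\<close> and \<open>D (I + h S)\<close> on that of
  \<open>D\<close>. Inverting the two parts gives \<open>P / h\<close> and
  \<open>(I + h S)^(-1) S\<close>. The condition \<open>P \<noteq> 0\<close> makes the principal
  part nonzero and excludes \<open>1\<close> from the resolvent set.\<close>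

lemma simple_pole_of_reduced_resolvent:
  fixes T :: "'a::complex_banach \<Rightarrow>\<^sub>L 'a"
  defines "D \<equiv> id_blinfun - T"
  assumes L: "T \<in> L_ops" "P \<in> L_ops" "S \<in> L_ops"
    and DP: "D o\<^sub>L P = 0" and PD: "P o\<^sub>L D = 0" and PS: "P o\<^sub>L S = 0" and SP: "S o\<^sub>L P = 0"
    and DS: "D o\<^sub>L S = id_blinfun - P" and SD: "S o\<^sub>L D = id_blinfun - P"
    and "P \<noteq> 0"
  shows "simple_pole (resolvent T) (resolvent_set T) 1"
proof -
  have LD: "D \<in> L_ops" unfolding D_def by (intro L_ops_closed L)
  \<comment> \<open>This radius ensures \<open>cmod h * norm S < 1\<close>, and the added
    \<open>1\<close> covers \<open>S = 0\<close>.\<close>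
  define r where "r = 1 / (norm S + 1)"
  have r: "0 < r" unfolding r_def by (simp add: add_nonneg_pos)
  \<comment> \<open>Expanding \<open>V o\<^sub>L S\<close> in the Neumann series gives
    \<open>(-S)^n S\<close> as the coefficient of \<open>h^n\<close>, and \<open>P\<close> is the
    coefficient of \<open>h^(-1)\<close>.\<close>
  define c where "c m = (if m < 0 then P else blinfun_power (- S) (nat m) o\<^sub>L S)" for m :: int
  have main: "is_inverse_op (z *\<^sub>C id_blinfun - T) R \<and>
      (\<lambda>n. (z - 1) powi (int n - 1) *\<^sub>C c (int n - 1)) sums R"
    if z: "0 < cmod (z - 1)" "cmod (z - 1) < r" "R = resolvent T z" for z R
  proof -
    define h where "h = z - 1"
    have h: "h \<noteq> 0" "cmod h < r" using z by (auto simp: h_def)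
    have "norm ((- h) *\<^sub>C S) < 1"
    proof -
      have "cmod h * norm S \<le> cmod h * (norm S + 1)" by (simp add: mult_left_mono)
      also have "\<dots> < 1" using h(2) by (simp add: r_def pos_less_divide_eq add_nonneg_pos)
      finally show ?thesis by (simp add: norm_scaleC)
    qed
    then obtain V where V: "V o\<^sub>L (id_blinfun - (- h) *\<^sub>C S) = id_blinfun"
        "(id_blinfun - (- h) *\<^sub>C S) o\<^sub>L V = id_blinfun" "blinfun_power ((- h) *\<^sub>C S) sums V"
      by (rule neumann_series_norm_less_1)
    have V1: "(id_blinfun + h *\<^sub>C S) o\<^sub>L V = id_blinfun" and V2: "V o\<^sub>L (id_blinfun + h *\<^sub>C S) = id_blinfun"
      using V by (simp_all add: scaleC.minus_left)
    have LV: "V \<in> L_ops"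
      by (rule L_ops_inverse[OF _ V2 V1]) (intro L_ops_closed L)
    have PV: "P o\<^sub>L V = P"
    proof -
      have "P o\<^sub>L ((id_blinfun + h *\<^sub>C S) o\<^sub>L V) = P" by (simp add: V1)
      then show ?thesis
        by (simp flip: blinfun_compose_assoc)
          (simp add: blinfun_compose.add_right scaleC_blinfun_compose L PS scaleC.zero_right)
    qed
    have VP: "V o\<^sub>L P = P"
    proof -
      have "(V o\<^sub>L (id_blinfun + h *\<^sub>C S)) o\<^sub>L P = P" by (simp add: V2)
      then show ?thesis
        by (simp add: blinfun_compose_assoc blinfun_compose.add_left scaleC_blinfun_compose SP scaleC.zero_right)
    qed
    \<comment> \<open>Commutation lets \<open>S\<close> be moved next to \<open>D\<close> in the
      product on the left, where \<open>D o\<^sub>L S\<close> is known.\<close>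
    have VS: "V o\<^sub>L S = S o\<^sub>L V"
    proof -
      have "S o\<^sub>L (id_blinfun + h *\<^sub>C S) = (id_blinfun + h *\<^sub>C S) o\<^sub>L S"
        by (simp add: blinfun_compose.add_left blinfun_compose.add_right scaleC_blinfun_compose L)
      then have "V o\<^sub>L (S o\<^sub>L (id_blinfun + h *\<^sub>C S)) o\<^sub>L V = V o\<^sub>L ((id_blinfun + h *\<^sub>C S) o\<^sub>L S) o\<^sub>L V"
        by simp
      then have "(V o\<^sub>L S) o\<^sub>L ((id_blinfun + h *\<^sub>C S) o\<^sub>L V) = (V o\<^sub>L (id_blinfun + h *\<^sub>C S)) o\<^sub>L (S o\<^sub>L V)"
        by (simp only: blinfun_compose_assoc)
      then show ?thesis by (simp add: V1 V2)
    qed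
    define Q where "Q = (1 / h) *\<^sub>C P + (V o\<^sub>L S)"
    have zT: "z *\<^sub>C id_blinfun - T = h *\<^sub>C id_blinfun + D"
      by (simp add: h_def D_def scaleC.diff_left)
    have "(h *\<^sub>C id_blinfun + D) o\<^sub>L Q = id_blinfun"
    proof -
      have "(h *\<^sub>C id_blinfun + D) o\<^sub>L (S o\<^sub>L V) = ((id_blinfun + h *\<^sub>C S) - P) o\<^sub>L V"
        by (simp flip: blinfun_compose_assoc)
          (simp add: blinfun_compose.add_left DS scaleC_blinfun_compose algebra_simps)
      also have "\<dots> = id_blinfun - P" by (simp add: blinfun_compose.diff_left V1 PV)
      finally show ?thesis
        using h by (simp add: Q_def VS blinfun_compose.add_left blinfun_compose.add_right
            scaleC_blinfun_compose scaleC_scaleC DP LD scaleC.zero_right)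
    qed
    moreover have "Q o\<^sub>L (h *\<^sub>C id_blinfun + D) = id_blinfun"
    proof -
      have "(V o\<^sub>L S) o\<^sub>L (h *\<^sub>C id_blinfun + D) = V o\<^sub>L ((id_blinfun + h *\<^sub>C S) - P)"
        by (simp add: blinfun_compose_assoc)
          (simp add: blinfun_compose.add_right SD scaleC_blinfun_compose L algebra_simps)
      also have "\<dots> = id_blinfun - P" by (simp add: blinfun_compose.diff_right V2 VP)
      finally show ?thesis
        using h by (simp add: Q_def blinfun_compose.add_left[of "(1 / h) *\<^sub>C P"])
          (simp add: blinfun_compose.add_right
            scaleC_blinfun_compose scaleC_scaleC PD L scaleC.zero_right)
    qed
    moreover have "Q \<in> L_ops" unfolding Q_def by (intro L_ops_closed L LV)
    ultimately have inv: "is_inverse_op (z *\<^sub>C id_blinfun - T) Q"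
      by (simp add: is_inverse_op_def zT)
    have "(\<lambda>n. h powi (int n - 1) *\<^sub>C c (int n - 1)) sums Q"
    proof -
      have "(\<lambda>n. blinfun_power ((- h) *\<^sub>C S) n o\<^sub>L S) sums (V o\<^sub>L S)"
        by (rule bounded_linear.sums[OF blinfun_compose.bounded_linear_left V(3)])
      moreover have "blinfun_power ((- h) *\<^sub>C S) n = h ^ n *\<^sub>C blinfun_power (- S) n" for n
      proof -
        have "(- h) *\<^sub>C S = h *\<^sub>C (- S)" by (simp add: scaleC.minus_left scaleC.minus_right)
        moreover have "- S \<in> L_ops" using L_ops_closed(5)[OF L(3), of "-1"] by (simp add: scaleC.minus_left)
        ultimately show ?thesis by (simp add: blinfun_power_scaleC)
      qed
      ultimately have "(\<lambda>n. h powi (int (Suc n) - 1) *\<^sub>C c (int (Suc n) - 1)) sums (V o\<^sub>L S)"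
        by (simp add: c_def scaleC_blinfun_compose)
      then show ?thesis
        by (subst (asm) sums_Suc_iff) (simp add: c_def Q_def power_int_minus inverse_eq_divide add.commute)
    qed
    with inv show ?thesis using z(3) resolvent_eqI[OF inv] by (simp add: h_def)
  qed
  have "1 \<notin> resolvent_set T"
  proof
    assume "1 \<in> resolvent_set T"
    then obtain W where "W o\<^sub>L D = id_blinfun"
      by (auto simp: resolvent_set_def is_inverse_op_def D_def)
    then have "P = W o\<^sub>L (D o\<^sub>L P)" by (simp flip: blinfun_compose_assoc)
    then show False using DP \<open>P \<noteq> 0\<close> by simp
  qed
  moreover have "c (- int 1) \<noteq> 0" using \<open>P \<noteq> 0\<close> by (simp add: c_def)
  moreover have "z \<in> resolvent_set T \<and>
      (\<lambda>n. (z - 1) powi (int n - int 1) *\<^sub>C c (int n - int 1)) sums resolvent T z"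
    if "0 < cmod (z - 1) \<and> cmod (z - 1) < r" for z
    using main[of z "resolvent T z"] that by (auto simp: resolvent_set_def)
  ultimately show ?thesis unfolding pole_of_order_def using r by blast
qed

section \<open>The spectral radius\<close>

lemma resolvent_identity:
  fixes R :: "complex \<Rightarrow> 'a::complex_banach \<Rightarrow>\<^sub>L 'a"
  assumes "R z \<in> L_ops" "R z o\<^sub>L (z *\<^sub>C id_blinfun - T) = id_blinfun"
    "(w *\<^sub>C id_blinfun - T) o\<^sub>L R w = id_blinfun"
  shows "R z - R w = (w - z) *\<^sub>C (R z o\<^sub>L R w)"
proof -
  have "R z - R w = (R z o\<^sub>L ((w *\<^sub>C id_blinfun - T) o\<^sub>L R w)) -
      ((R z o\<^sub>L (z *\<^sub>C id_blinfun - T)) o\<^sub>L R w)"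
    by (simp add: assms)
  also have "\<dots> = R z o\<^sub>L (((w *\<^sub>C id_blinfun - T) - (z *\<^sub>C id_blinfun - T)) o\<^sub>L R w)"
    by (simp add: blinfun_compose_assoc blinfun_compose.diff_left blinfun_compose.diff_right)
  also have "(w *\<^sub>C id_blinfun - T) - (z *\<^sub>C id_blinfun - T) = (w - z) *\<^sub>C id_blinfun"
    by (simp add: scaleC.diff_left)
  finally show ?thesis by (simp add: scaleC_blinfun_compose assms)
qed

text \<open>The resolvent identity alone suffices: near \<open>w\<close> it first bounds
  \<open>norm (R z)\<close> by \<open>2 * norm (R w)\<close>, then gives continuity, and finally the
  derivative \<open>- R w o\<^sub>L R w\<close>.\<close>

lemma entire_resolvent_has_derivative:
  fixes R :: "complex \<Rightarrow> 'a::complex_banach \<Rightarrow>\<^sub>L 'a"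
  assumes ident: "\<And>z w. R z - R w = (w - z) *\<^sub>C (R z o\<^sub>L R w)"
  shows "isCont R w" and "(R has_derivative (\<lambda>h. h *\<^sub>C - (R w o\<^sub>L R w))) (at w)"
proof -
  have bound: "norm (R z - R w) \<le> cmod (z - w) * (2 * norm (R w) * norm (R w))"
    if "cmod (z - w) * norm (R w) \<le> 1 / 2" for z
  proof -
    have le: "norm (R z - R w) \<le> cmod (z - w) * (norm (R z) * norm (R w))"
      unfolding ident[of z w] norm_scaleC
      by (simp add: norm_minus_commute mult_left_mono norm_blinfun_compose)
    also have "\<dots> = (cmod (z - w) * norm (R w)) * norm (R z)" by simp
    also have "\<dots> \<le> 1 / 2 * norm (R z)" using that by (intro mult_right_mono) simp_all
    finally have "norm (R z) \<le> 2 * norm (R w)"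
      using norm_triangle_ineq2[of "R z" "R w"] by simp
    then have "cmod (z - w) * (norm (R z) * norm (R w)) \<le> cmod (z - w) * (2 * norm (R w) * norm (R w))"
      by (intro mult_left_mono mult_right_mono) simp_all
    with le show ?thesis by simp
  qed
  have small: "((\<lambda>z. cmod (z - w) * norm (R w)) \<longlongrightarrow> 0) (at w)"
    by (rule tendsto_eq_intros refl | simp)+
  show cont: "isCont R w"
    unfolding isCont_def
  proof (rule LIM_zero_cancel, rule Lim_null_comparison)
    show "\<forall>\<^sub>F z in at w. norm (R z - R w) \<le> cmod (z - w) * (2 * norm (R w) * norm (R w))"
    proof (rule eventually_mono)
      show "\<forall>\<^sub>F z in at w. cmod (z - w) * norm (R w) < 1 / 2"
        by (rule order_tendstoD(2)[OF small]) simp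
    qed (use bound in auto)
    show "((\<lambda>z. cmod (z - w) * (2 * norm (R w) * norm (R w))) \<longlongrightarrow> 0) (at w)"
      by (rule tendsto_eq_intros refl | simp)+
  qed
  show "(R has_derivative (\<lambda>h. h *\<^sub>C - (R w o\<^sub>L R w))) (at w)"
    unfolding has_derivative_iff_norm
  proof
    show "bounded_linear (\<lambda>h. h *\<^sub>C - (R w o\<^sub>L R w))" by (rule scaleC.bounded_linear_left)
    \<comment> \<open>The remainder is \<open>(w - z) (R z - R w) R w\<close>: after division by
      \<open>norm (z - w)\<close>, continuity finishes the argument.\<close>
    have le: "norm ((R z - R w) - (z - w) *\<^sub>C - (R w o\<^sub>L R w)) / norm (z - w)
        \<le> norm (R z - R w) * norm (R w)" for z
    proof -
      have "(R z - R w) - (z - w) *\<^sub>C - (R w o\<^sub>L R w) = (w - z) *\<^sub>C ((R z - R w) o\<^sub>L R w)"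
        unfolding blinfun_compose.diff_left unfolding ident[of z w]
        by (simp add: scaleC.diff_right scaleC.diff_left scaleC.minus_right)
      then have "norm ((R z - R w) - (z - w) *\<^sub>C - (R w o\<^sub>L R w)) =
          norm (z - w) * norm ((R z - R w) o\<^sub>L R w)"
        by (simp only: norm_scaleC norm_minus_commute[of w z])
      also have "\<dots> \<le> norm (z - w) * (norm (R z - R w) * norm (R w))"
        by (intro mult_left_mono norm_blinfun_compose norm_ge_zero)
      finally have "norm ((R z - R w) - (z - w) *\<^sub>C - (R w o\<^sub>L R w)) \<le>
          norm (z - w) * (norm (R z - R w) * norm (R w))" .
      then show ?thesis by (cases "z = w") (simp_all add: field_simps)
    qed
    have lim: "((\<lambda>z. norm (R z - R w) * norm (R w)) \<longlongrightarrow> 0) (at w)"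
      using cont[unfolded isCont_def] by (intro tendsto_mult_left_zero tendsto_norm_zero LIM_zero)
    show "((\<lambda>z. norm ((R z - R w) - (z - w) *\<^sub>C - (R w o\<^sub>L R w)) / norm (z - w)) \<longlongrightarrow> 0) (at w)"
    proof (rule tendsto_sandwich[OF _ _ tendsto_const lim]; rule always_eventually; rule allI)
      fix z
      show "0 \<le> norm ((R z - R w) - (z - w) *\<^sub>C - (R w o\<^sub>L R w)) / norm (z - w)"
        by (rule divide_nonneg_nonneg) (rule norm_ge_zero)+
      show "norm ((R z - R w) - (z - w) *\<^sub>C - (R w o\<^sub>L R w)) / norm (z - w) \<le> norm (R z - R w) * norm (R w)"
        by (rule le)
    qed
  qed
qed

text \<open>Liouville's theorem in disguise: the circle means
  \<open>\<integral>\<^sub>0\<^sup>2\<^sup>\<pi> R (r e\<^sup>i\<^sup>\<theta>) d\<theta>\<close> do not depend on \<open>r\<close>, because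
  \<open>\<i> r \<partial>\<^sub>r R (r e\<^sup>i\<^sup>\<theta>) = \<partial>\<^sub>\<theta> R (r e\<^sup>i\<^sup>\<theta>)\<close>. They
  vanish at infinity, hence at \<open>r = 0\<close>.\<close>

lemma op_spectrum_nonempty:
  fixes T :: "'a::complex_banach \<Rightarrow>\<^sub>L 'a"
  assumes "(UNIV :: 'a set) \<noteq> {0}"
  shows "op_spectrum T \<noteq> {}"
proof
  assume "op_spectrum T = {}"
  then have inv: "is_inverse_op (z *\<^sub>C id_blinfun - T) (resolvent T z)" for z
    by (intro is_inverse_op_resolvent) (auto simp: op_spectrum_def)
  define R where "R = resolvent T"
  have R: "R z \<in> L_ops" "R z o\<^sub>L (z *\<^sub>C id_blinfun - T) = id_blinfun"
    "(z *\<^sub>C id_blinfun - T) o\<^sub>L R z = id_blinfun" for z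
    using inv by (simp_all add: is_inverse_op_def R_def)
  have ident: "R z - R w = (w - z) *\<^sub>C (R z o\<^sub>L R w)" for z w
    by (rule resolvent_identity) (rule R)+
  note R_cont = entire_resolvent_has_derivative(1)[OF ident]
  note R_der = entire_resolvent_has_derivative(2)[OF ident]
  define R' where "R' z = - (R z o\<^sub>L R z)" for z
  have R_on: "continuous_on S R" for S
    using R_cont by (simp add: continuous_at_imp_continuous_on)
  have [continuous_intros]: "continuous_on S (\<lambda>x. R (g x))" "continuous_on S (\<lambda>x. R' (g x))"
    if "continuous_on S g" for S and g :: "'b::topological_space \<Rightarrow> complex"
    unfolding R'_def using continuous_on_compose2[OF R_on[of UNIV] that]
    by (auto intro!: continuous_intros blinfun_compose.continuous_on)
  have [continuous_intros]: "continuous_on S (\<lambda>x. cis (g x))"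
    if "continuous_on S g" for S and g :: "'b::topological_space \<Rightarrow> real"
    using that by (rule continuous_on_cis)
  define M where "M r = integral (cbox 0 (2 * pi)) (\<lambda>t. R (complex_of_real r * cis t))" for r
  define M' where "M' r = integral (cbox 0 (2 * pi)) (\<lambda>t. cis t *\<^sub>C R' (complex_of_real r * cis t))" for r
  have M_der: "(M has_vector_derivative M' r) (at r)" for r
    unfolding M_def M'_def
  proof (rule leibniz_rule_vector_derivative[where U = UNIV])
    fix x t :: real
    have "((\<lambda>x. complex_of_real x * cis t) has_derivative (\<lambda>h. complex_of_real h * cis t)) (at x)"
      by (auto intro!: derivative_eq_intros)
    from has_derivative_compose[OF this R_der]
    show "((\<lambda>x. R (complex_of_real x * cis t)) has_vector_derivative
        cis t *\<^sub>C R' (complex_of_real x * cis t)) (at x within UNIV)"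
      by (simp add: has_vector_derivative_def R'_def scaleR_scaleC scaleC_scaleC)
  next
    show "(\<lambda>t. R (complex_of_real x * cis t)) integrable_on cbox 0 (2 * pi)" for x
      by (intro integrable_continuous continuous_intros)
    show "continuous_on (UNIV \<times> cbox 0 (2 * pi)) (\<lambda>(x, t). cis t *\<^sub>C R' (complex_of_real x * cis t))"
      unfolding case_prod_beta
      by (intro scaleC.continuous_on continuous_intros)
  qed simp_all
  \<comment> \<open>\<open>\<i> r M' r\<close> is the integral of an angular derivative over a full
    period, hence zero. Dividing by \<open>\<i> r\<close> requires \<open>r \<noteq> 0\<close>, so
    radius \<open>0\<close> is the exceptional point when constancy of \<open>M\<close> is
    derived.\<close>
  have M'_0: "M' r = 0" if "r \<noteq> 0" for r
  proof -
    have "((\<lambda>t. (\<i> * complex_of_real r * cis t) *\<^sub>C R' (complex_of_real r * cis t)) has_integral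
        R (complex_of_real r * cis (2 * pi)) - R (complex_of_real r * cis 0)) {0..2 * pi}"
    proof (rule fundamental_theorem_of_calculus)
      fix t :: real
      have "((\<lambda>t. complex_of_real r * cis t) has_derivative
          (\<lambda>h. h *\<^sub>R (complex_of_real r * (\<i> * cis t)))) (at t within {0..2*pi})"
        by (auto intro!: derivative_eq_intros)
      from has_derivative_compose[OF this R_der]
      show "((\<lambda>t. R (complex_of_real r * cis t)) has_vector_derivative
          (\<i> * complex_of_real r * cis t) *\<^sub>C R' (complex_of_real r * cis t)) (at t within {0..2*pi})"
        by (simp add: has_vector_derivative_def R'_def scaleC.scaleR_left mult_ac)
    qed simp
    then have "integral (cbox 0 (2*pi)) (\<lambda>t. (\<i> * complex_of_real r) *\<^sub>C (cis t *\<^sub>C R' (complex_of_real r * cis t))) = 0"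
      by (simp add: scaleC_scaleC has_integral_integral integral_unique)
    moreover have "integral (cbox 0 (2*pi)) ((\<lambda>x. (\<i> * complex_of_real r) *\<^sub>C x) \<circ> (\<lambda>t. cis t *\<^sub>C R' (complex_of_real r * cis t)))
       = (\<i> * complex_of_real r) *\<^sub>C M' r"
      unfolding M'_def
      by (intro integral_linear integrable_continuous scaleC.continuous_on continuous_intros
          bounded_linear_scaleC_right)
    ultimately have "(\<i> * complex_of_real r) *\<^sub>C M' r = 0" by (simp add: o_def)
    then have "norm ((\<i> * complex_of_real r) *\<^sub>C M' r) = 0" by simp
    then show ?thesis using that by (simp add: norm_scaleC norm_mult)
  qed
  have M_const: "M K = M 0" if "0 \<le> K" for K
  proof (rule has_derivative_zero_unique_strong_interval[where k = "{0}" and a = 0 and b = K])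
    show "continuous_on {0..K} M"
      using M_der by (meson continuous_at_imp_continuous_on has_vector_derivative_continuous)
    show "(M has_derivative (\<lambda>h. 0)) (at x within {0..K})" if "x \<in> {0..K} - {0}" for x
      using M_der[of x] M'_0[of x] that
      by (auto simp: has_vector_derivative_def intro: has_derivative_at_withinI)
  qed (use that in auto)
  \<comment> \<open>From \<open>z R(z) = I + T R(z)\<close>. It supplies the decay that forces the
    circle means to vanish at infinity.\<close>
  have R_bound: "norm (R z) \<le> 1 / (cmod z - norm T)" if "norm T < cmod z" for z
  proof -
    have "z *\<^sub>C R z = id_blinfun + (T o\<^sub>L R z)"
      using R(3)[of z] by (simp add: blinfun_compose.diff_left scaleC_blinfun_compose algebra_simps)
    then have "cmod z * norm (R z) = norm (id_blinfun + (T o\<^sub>L R z))" by (metis norm_scaleC)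
    also have "\<dots> \<le> norm (id_blinfun :: 'a \<Rightarrow>\<^sub>L 'a) + norm (T o\<^sub>L R z)" by (rule norm_triangle_ineq)
    also have "\<dots> \<le> 1 + norm T * norm (R z)"
      by (intro add_mono norm_blinfun_id_le norm_blinfun_compose)
    finally show ?thesis using that by (simp add: field_simps)
  qed
  have "norm (M 0) \<le> 1 / (K - norm T) * (2 * pi)" if K: "norm T < K" for K
  proof -
    have K0: "0 \<le> K" using K norm_ge_zero[of T] by linarith
    have "norm (M K) \<le> 1 / (K - norm T) * measure lborel (cbox 0 (2 * pi))"
      unfolding M_def
    proof (rule integrable_bound)
      show "norm (R (complex_of_real K * cis x)) \<le> 1 / (K - norm T)" for x
        using R_bound[of "complex_of_real K * cis x"] K K0 by (simp add: norm_mult)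
    qed (use K in \<open>auto intro!: integrable_continuous_interval continuous_intros\<close>)
    then show ?thesis using M_const[OF K0] by simp
  qed
  then have "eventually (\<lambda>K. norm (M 0) \<le> 1 / (K - norm T) * (2 * pi)) at_top"
    using eventually_gt_at_top[of "norm T"] by (rule eventually_mono[rotated])
  moreover have "((\<lambda>K. 1 / (K - norm T) * (2 * pi)) \<longlongrightarrow> 0) at_top"
    by (intro tendsto_mult_left_zero tendsto_divide_0[OF tendsto_const] filterlim_at_top_imp_at_infinity
        filterlim_tendsto_add_at_top[OF tendsto_const[of "- norm T"] filterlim_ident, simplified])
  ultimately have "norm (M 0) \<le> 0"
    by (intro tendsto_lowerbound) auto
  \<comment> \<open>At radius \<open>0\<close> the integrand is constant, so \<open>R 0 = 0\<close>.
    But \<open>R 0\<close> inverts \<open>- T\<close>, and the identity of a nonzero space would be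
    zero.\<close>
  moreover have "M 0 = (2 * pi) *\<^sub>R R 0" by (simp add: M_def)
  ultimately have "R 0 = 0" using pi_gt_zero by (simp add: mult_le_0_iff)
  then have id0: "(id_blinfun :: 'a \<Rightarrow>\<^sub>L 'a) = 0" using R(2)[of 0] by simp
  have "x = 0" for x :: 'a
    using arg_cong[OF id0, of "\<lambda>A. blinfun_apply A x"] by simp
  then show False using assms by auto
qed

section \<open>Polynomial growth of the powers and the exterior of the unit disc\<close>

lemma growth_order_finite_imp_bound:
  assumes "growth_order b < \<infinity>"
  obtains m C where "\<And>n. 1 \<le> n \<Longrightarrow> b n \<le> C * real n ^ m"
proof -
  have "{enat m | m. bdd_above ((\<lambda>n. b n / real n ^ m) ` {1..})} \<noteq> {}"
    using assms unfolding growth_order_def by (metis Inf_empty infinity_ne_i0 less_irrefl top_enat_def)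
  then obtain m where "bdd_above ((\<lambda>n. b n / real n ^ m) ` {1..})" by blast
  then obtain C where "\<And>n. 1 \<le> n \<Longrightarrow> b n / real n ^ m \<le> C"
    unfolding bdd_above_def by auto
  then have "b n \<le> C * real n ^ m" if "1 \<le> n" for n using that by (simp add: field_simps)
  then show ?thesis by (rule that)
qed

text \<open>Ratio test: the quotients of consecutive terms tend to \<open>x\<close>, hence are
  eventually below the midpoint \<open>c\<close> of \<open>x\<close> and \<open>1\<close>.\<close>

lemma summable_power_mult_geometric:
  fixes x :: real
  assumes "0 \<le> x" "x < 1"
  shows "summable (\<lambda>n. real n ^ m * x ^ n)"
proof -
  define c where "c = (1 + x) / 2"
  have c: "x < c" "c < 1" using assms by (simp_all add: c_def)
  have "(\<lambda>n. (real (Suc n) / real n) ^ m * x) \<longlonglongrightarrow> 1 ^ m * x"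
    by (intro tendsto_intros LIMSEQ_Suc_n_over_n)
  then have "eventually (\<lambda>n. (real (Suc n) / real n) ^ m * x < c \<and> 0 < n) sequentially"
    using c by (intro eventually_conj order_tendstoD(2) eventually_gt_at_top) simp_all
  then obtain N where N: "\<And>n. N \<le> n \<Longrightarrow> (real (Suc n) / real n) ^ m * x < c \<and> 0 < n"
    unfolding eventually_sequentially by blast
  show ?thesis
  proof (rule summable_ratio_test[OF c(2)])
    fix n assume "N \<le> n"
    note n = N[OF this]
    have "real (Suc n) ^ m * x ^ Suc n = (real (Suc n) / real n) ^ m * x * (real n ^ m * x ^ n)"
      using n by (simp add: power_divide)
    also have "\<dots> \<le> c * (real n ^ m * x ^ n)"
      using n assms by (intro mult_right_mono) (auto simp del: of_nat_Suc)
    finally show "norm (real (Suc n) ^ m * x ^ Suc n) \<le> c * norm (real n ^ m * x ^ n)"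
      using assms by (simp add: abs_mult del: of_nat_Suc power_Suc)
  qed
qed

text \<open>The resolvent is \<open>(1 / z) (I - T / z)^(-1)\<close>, whose Neumann series converges
  because geometric decay beats polynomial growth.\<close>

lemma in_resolvent_set_if_polynomial_growth:
  fixes T :: "'a::complex_banach \<Rightarrow>\<^sub>L 'a"
  assumes T: "T \<in> L_ops" and bound: "\<And>n. 1 \<le> n \<Longrightarrow> norm (blinfun_power T n) \<le> C * real n ^ m"
    and z: "1 < cmod z"
  shows "z \<in> resolvent_set T"
proof -
  have z0: "z \<noteq> 0" using z by auto
  have "summable (\<lambda>n. norm (blinfun_power ((1 / z) *\<^sub>C T) n))"
  proof (rule summable_comparison_test')
    show "summable (\<lambda>n. C * (real n ^ m * (1 / cmod z) ^ n))"
      using z by (intro summable_mult summable_power_mult_geometric) (auto simp: divide_less_eq)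
    fix n :: nat assume "1 \<le> n"
    then have "(1 / cmod z) ^ n * norm (blinfun_power T n) \<le> (1 / cmod z) ^ n * (C * real n ^ m)"
      by (intro mult_left_mono bound) simp_all
    then show "norm (norm (blinfun_power ((1 / z) *\<^sub>C T) n)) \<le> C * (real n ^ m * (1 / cmod z) ^ n)"
      by (simp add: blinfun_power_scaleC T norm_scaleC norm_power norm_divide mult_ac)
  qed
  then obtain V where V: "V o\<^sub>L (id_blinfun - (1 / z) *\<^sub>C T) = id_blinfun"
      "(id_blinfun - (1 / z) *\<^sub>C T) o\<^sub>L V = id_blinfun"
    by (rule neumann_series)
  have LV: "V \<in> L_ops" by (rule L_ops_inverse[OF _ V]) (intro L_ops_closed T)
  have "z *\<^sub>C id_blinfun - T = z *\<^sub>C (id_blinfun - (1 / z) *\<^sub>C T)"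
    using z0 by (simp add: scaleC.diff_right scaleC_scaleC)
  moreover have "is_inverse_op (z *\<^sub>C (id_blinfun - (1 / z) *\<^sub>C T)) ((1 / z) *\<^sub>C V)"
    unfolding is_inverse_op_def using z0 V LV
    by (simp add: scaleC_blinfun_compose L_ops_closed T scaleC_scaleC)
  ultimately show ?thesis unfolding resolvent_set_def by auto
qed

section \<open>Convergence of the means\<close>

text \<open>The weight is left arbitrary so that one set of identities serves \<open>s\<close> and
  all its iterated differences.\<close>

definition op_convolution :: "(nat \<Rightarrow> real) \<Rightarrow> ('a::real_normed_vector \<Rightarrow>\<^sub>L 'a) \<Rightarrow> nat \<Rightarrow> ('a \<Rightarrow>\<^sub>L 'a)"
  where "op_convolution a T n = (\<Sum>k\<le>n. a (n - k) *\<^sub>R blinfun_power T k)"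

lemma s_means_eq: "s_means s T n = (1 / s n) *\<^sub>R op_convolution (Delta s) T n"
  by (simp add: s_means_def op_convolution_def atMost_atLeast0)

lemma op_convolution_Suc:
  "op_convolution a T (Suc n) = a (Suc n) *\<^sub>R id_blinfun + (T o\<^sub>L op_convolution a T n)"
  unfolding op_convolution_def
  by (subst sum.atMost_Suc_shift)
    (simp add: blinfun_compose.sum_right blinfun_compose.scaleR_right)

text \<open>The convention \<open>Delta a 0 = a 0\<close> matters here: it matches the term
  \<open>k = Suc n\<close>, which has no counterpart in the convolution at \<open>n\<close>.\<close>

lemma op_convolution_Delta:
  "op_convolution (Delta a) T (Suc n) = op_convolution a T (Suc n) - op_convolution a T n"
  unfolding op_convolution_def
  by (simp add: Delta_def Suc_diff_le scaleR_diff_left flip: sum_subtractf)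

lemma op_convolution_commutes:
  assumes "A o\<^sub>L T = T o\<^sub>L A"
  shows "A o\<^sub>L op_convolution a T n = op_convolution a T n o\<^sub>L A"
  unfolding op_convolution_def
  by (simp add: blinfun_compose.sum_right blinfun_compose.sum_left blinfun_compose.scaleR_left
      blinfun_compose.scaleR_right blinfun_power_commutes[OF assms])

text \<open>Splitting off the term \<open>k = 0\<close> expresses \<open>T\<close> times the
  convolution through the convolution at \<open>Suc n\<close>; the difference of consecutive
  convolutions is again a convolution, with weight \<open>Delta a\<close>.\<close>

lemma diff_id_compose_op_convolution:
  "(id_blinfun - T) o\<^sub>L op_convolution a T n =
    a (Suc n) *\<^sub>R id_blinfun - op_convolution (Delta a) T (Suc n)"
  unfolding op_convolution_Delta unfolding op_convolution_Suc
  by (simp add: blinfun_compose.diff_left)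

text \<open>Monotonicity of \<open>s\<close> bounds \<open>norm (blinfun_power T k) / s n\<close> by
  \<open>u k\<close> for \<open>k \<le> n\<close>. The sum of
  \<open>\<bar>a k\<bar> * u (n - k)\<close> then tends to \<open>0\<close> by Tannery's theorem,
  with dominating series \<open>\<bar>a k\<bar> * K\<close>.\<close>

lemma op_convolution_ell1_tendsto_0:
  fixes T :: "'a::banach \<Rightarrow>\<^sub>L 'a"
  assumes a: "a \<in> ell1" and s: "mono s" "\<And>n. 0 < s n"
    and T: "(\<lambda>n. norm (blinfun_power T n) / s n) \<longlonglongrightarrow> 0"
  shows "(\<lambda>n. (1 / s n) *\<^sub>R op_convolution a T n) \<longlonglongrightarrow> 0"
proof -
  define u where "u n = norm (blinfun_power T n) / s n" for n
  have u0: "0 \<le> u n" for n using s(2)[of n] by (simp add: u_def)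
  have "Bseq u" using T unfolding u_def by (intro convergent_imp_Bseq convergentI)
  then obtain K where K: "\<And>n. u n \<le> K" "0 < K" by (auto simp: Bseq_def u0)
  \<comment> \<open>Extension by zero beyond \<open>n\<close> turns the finite sums into series over
    a fixed index set.\<close>
  define f where "f k n = (if k \<le> n then \<bar>a k\<bar> * u (n - k) else 0)" for k n
  have "((\<lambda>n. suminf (\<lambda>k. f k n)) \<longlongrightarrow> suminf (\<lambda>k::nat. 0)) sequentially"
  proof (rule tannerys_theorem[THEN conjunct2, THEN conjunct2])
    fix k
    have "(\<lambda>n. \<bar>a k\<bar> * u (n - k)) \<longlonglongrightarrow> 0"
    proof (rule tendsto_mult_right_zero)
      have "(\<lambda>n. u (n + k - k)) \<longlonglongrightarrow> 0" using T by (simp add: u_def)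
      then show "(\<lambda>n. u (n - k)) \<longlonglongrightarrow> 0" by (rule LIMSEQ_offset)
    qed
    then show "(f k) \<longlonglongrightarrow> 0"
      unfolding f_def
      by (rule Lim_transform_eventually) (rule eventually_mono[OF eventually_ge_at_top[of k]], simp)
  next
    show "\<forall>\<^sub>F (k, n) in at_top \<times>\<^sub>F sequentially. norm (f k n) \<le> \<bar>a k\<bar> * K"
      using K u0 by (intro always_eventually) (auto simp: f_def abs_mult intro!: mult_left_mono)
    show "summable (\<lambda>k. \<bar>a k\<bar> * K)" using a by (intro summable_mult2) (simp add: ell1_def)
  qed simp
  then have "(\<lambda>n. \<Sum>k. f k n) \<longlonglongrightarrow> 0" by simp
  moreover have "norm ((1 / s n) *\<^sub>R op_convolution a T n) \<le> (\<Sum>k. f k n)" for n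
  proof -
    have "norm ((1 / s n) *\<^sub>R op_convolution a T n) \<le> (1 / s n) * (\<Sum>k\<le>n. \<bar>a (n - k)\<bar> * norm (blinfun_power T k))"
      unfolding op_convolution_def using s(2)[of n] norm_sum[of "\<lambda>k. a (n - k) *\<^sub>R blinfun_power T k" "{..n}"]
      by (simp add: divide_right_mono)
    also have "\<dots> = (\<Sum>k\<le>n. \<bar>a (n - k)\<bar> * (norm (blinfun_power T k) / s n))"
      by (simp add: sum_distrib_left)
    also have "\<dots> \<le> (\<Sum>k\<le>n. \<bar>a (n - k)\<bar> * u k)"
      unfolding u_def using s(2) monoD[OF s(1)]
      by (intro sum_mono mult_left_mono divide_left_mono mult_pos_pos) auto
    also have "\<dots> = (\<Sum>k\<le>n. f k n)"
      by (rule sum.reindex_bij_witness[of _ "\<lambda>k. n - k" "\<lambda>k. n - k"]) (auto simp: f_def)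
    also have "\<dots> = (\<Sum>k. f k n)"
      by (rule suminf_finite[symmetric]) (auto simp: f_def)
    finally show ?thesis .
  qed
  ultimately show ?thesis
    by (rule Lim_null_comparison[OF always_eventually[OF allI], rotated])
qed

lemma ratio_pred_tendsto_1:
  fixes s :: "nat \<Rightarrow> real"
  assumes "(\<lambda>n. s (n + 1) / s n) \<longlonglongrightarrow> 1"
  shows "(\<lambda>n. s n / s (Suc n)) \<longlonglongrightarrow> 1"
  using tendsto_inverse[OF assms] by simp

text \<open>Passing from \<open>j\<close> to \<open>Suc j\<close> subtracts the shifted ratio times
  \<open>s n / s (Suc n)\<close>, which tends to \<open>1\<close>. Equal limits cancel, so every
  difference of positive order is \<open>o(s)\<close>.\<close>

lemma iterated_Delta_ratio_tendsto:
  assumes s: "\<And>n. 0 < s n" "(\<lambda>n. s (n + 1) / s n) \<longlonglongrightarrow> (1::real)"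
  shows "(\<lambda>n. (Delta ^^ j) s n / s n) \<longlonglongrightarrow> (if j = 0 then 1 else 0)"
proof (induction j)
  case 0
  have "s n / s n = 1" for n using s(1)[of n] by simp
  then show ?case by simp
next
  case (Suc j)
  let ?L = "if j = 0 then 1 else 0 :: real" and ?\<tau> = "\<lambda>n. (Delta ^^ j) s n / s n"
  have "(\<lambda>n. ?\<tau> (Suc n) - ?\<tau> n * (s n / s (Suc n))) \<longlonglongrightarrow> ?L - ?L * 1"
    by (intro tendsto_intros LIMSEQ_Suc[OF Suc] Suc ratio_pred_tendsto_1 s(2))
  moreover have "?\<tau> (Suc n) - ?\<tau> n * (s n / s (Suc n)) = (Delta ^^ Suc j) s (Suc n) / s (Suc n)" for n
    using s(1)[of n] by (simp add: Delta_def diff_divide_distrib)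
  ultimately have "(\<lambda>n. (Delta ^^ Suc j) s (Suc n) / s (Suc n)) \<longlonglongrightarrow> 0" by simp
  then show ?case using LIMSEQ_imp_Suc[of "\<lambda>n. (Delta ^^ Suc j) s n / s n"] by simp
qed

text \<open>Each factor \<open>I - T\<close> turns the convolution with \<open>\<Delta>\<^sup>j s\<close> into the one with
  \<open>\<Delta>\<^sup>j\<^sup>+\<^sup>1 s\<close> up to a term of size \<open>o(s)\<close>, until the summable sequence \<open>\<Delta>\<^sup>q s\<close> is reached.\<close>

lemma power_compose_s_means_tendsto_0:
  fixes T :: "'a::banach \<Rightarrow>\<^sub>L 'a"
  assumes s: "mono s" "\<And>n. 0 < s n" "(\<lambda>n. s (n + 1) / s n) \<longlonglongrightarrow> 1"
    and q: "(Delta ^^ Suc q) s \<in> ell1"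
    and T: "(\<lambda>n. norm (blinfun_power T n) / s n) \<longlonglongrightarrow> 0"
  shows "(\<lambda>n. blinfun_power (id_blinfun - T) q o\<^sub>L s_means s T n) \<longlonglongrightarrow> 0"
proof -
  let ?D = "id_blinfun - T"
  let ?W = "\<lambda>j n. (1 / s n) *\<^sub>R op_convolution ((Delta ^^ j) s) T n"
  have "(\<lambda>n. blinfun_power ?D i o\<^sub>L ?W (Suc q - i) n) \<longlonglongrightarrow> 0" if "i \<le> q" for i
    using that
  proof (induction i)
    case 0
    then show ?case using op_convolution_ell1_tendsto_0[OF q s(1,2) T] by simp
  next
    case (Suc i)
    \<comment> \<open>The induction lowers the order of the difference: it starts at the summable
      one of order \<open>Suc q\<close> and ends at order \<open>1\<close>, the means. Thus
      \<open>j\<close> stays positive, and the term in \<open>(Delta ^^ j) s\<close> is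
      negligible.\<close>
    define j where "j = q - i"
    have j: "Suc q - Suc i = j" "Suc q - i = Suc j" "j \<noteq> 0" using Suc.prems by (auto simp: j_def)
    have eq: "blinfun_power ?D (Suc i) o\<^sub>L ?W j n = (s (n + 1) / s n) *\<^sub>R
        (((Delta ^^ j) s (Suc n) / s (Suc n)) *\<^sub>R blinfun_power ?D i
          - (blinfun_power ?D i o\<^sub>L ?W (Suc j) (Suc n)))" for n
    proof -
      have sn: "s n \<noteq> 0" "s (Suc n) \<noteq> 0" using s(2)[of n] s(2)[of "Suc n"] by simp_all
      have "blinfun_power ?D (Suc i) o\<^sub>L ?W j n =
          (1 / s n) *\<^sub>R (blinfun_power ?D i o\<^sub>L (?D o\<^sub>L op_convolution ((Delta ^^ j) s) T n))"
        by (simp add: blinfun_power_commutes blinfun_compose.scaleR_right flip: blinfun_compose_assoc)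
      also have "\<dots> = (1 / s n) *\<^sub>R ((Delta ^^ j) s (Suc n) *\<^sub>R blinfun_power ?D i -
          (blinfun_power ?D i o\<^sub>L op_convolution ((Delta ^^ Suc j) s) T (Suc n)))"
        by (simp add: diff_id_compose_op_convolution blinfun_compose.diff_right blinfun_compose.scaleR_right)
      also have "\<dots> = (s (n + 1) / s n) *\<^sub>R
        (((Delta ^^ j) s (Suc n) / s (Suc n)) *\<^sub>R blinfun_power ?D i
          - (blinfun_power ?D i o\<^sub>L ?W (Suc j) (Suc n)))"
        using sn by (simp add: scaleR_diff_right blinfun_compose.scaleR_right)
      finally show ?thesis .
    qed
    have "(\<lambda>n. blinfun_power ?D i o\<^sub>L ?W (Suc j) n) \<longlonglongrightarrow> 0"
      using Suc by (simp add: j)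
    moreover have "(\<lambda>n. (Delta ^^ j) s n / s n) \<longlonglongrightarrow> 0"
      using iterated_Delta_ratio_tendsto[OF s(2,3), of j] j(3) by simp
    ultimately have "(\<lambda>n. blinfun_power ?D (Suc i) o\<^sub>L ?W j n) \<longlonglongrightarrow> 1 *\<^sub>R (0 *\<^sub>R blinfun_power ?D i - 0)"
      unfolding eq by (intro tendsto_intros s(3)) (rule LIMSEQ_Suc, assumption)+
    then show ?case unfolding j(1) by simp
  qed
  from this[of q] show ?thesis by (simp add: s_means_eq)
qed

section \<open>From convergence of the means to the splitting of the space, and back\<close>

lemma s_means_Suc:
  assumes "\<And>n. 0 < s n"
  shows "s_means s T (Suc n) =
    id_blinfun - (1 / s (Suc n)) *\<^sub>R ((id_blinfun - T) o\<^sub>L op_convolution s T n)"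
proof -
  have "s (Suc n) \<noteq> 0" using assms[of "Suc n"] by simp
  then show ?thesis
    by (simp add: s_means_eq diff_id_compose_op_convolution scaleR_diff_right)
qed

lemma op_convolution_commutes_diff_id:
  "(id_blinfun - T) o\<^sub>L op_convolution a T n = op_convolution a T n o\<^sub>L (id_blinfun - T)"
  by (rule op_convolution_commutes) (simp add: blinfun_compose.diff_left blinfun_compose.diff_right)

text \<open>If \<open>(I - T)\<^sup>2 x = 0\<close> and \<open>y = (I - T) x\<close>, then the normalised sums
  \<open>z\<^sub>n = s(n)\<^sup>-\<^sup>1 \<Sum>\<^sub>k s(n - k) T\<^sup>k y\<close> converge and satisfy \<open>z\<^sub>n\<^sub>+\<^sub>1 = y + (s(n) / s(n + 1)) z\<^sub>n\<close>, which
  forces \<open>y = 0\<close> in the limit.\<close>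

lemma kernel_square_subset_kernel:
  fixes T :: "'a::banach \<Rightarrow>\<^sub>L 'a"
  defines "D \<equiv> id_blinfun - T"
  assumes s: "\<And>n. 0 < s n" "(\<lambda>n. s (n + 1) / s n) \<longlonglongrightarrow> 1"
    and P: "s_means s T \<longlonglongrightarrow> P"
    and x: "blinfun_apply D (blinfun_apply D x) = 0"
  shows "blinfun_apply D x = 0"
proof -
  define y where "y = blinfun_apply D x"
  define z where "z n = (1 / s n) *\<^sub>R blinfun_apply (op_convolution s T n) y" for n
  have s0: "s n \<noteq> 0" for n using s(1)[of n] by simp
  have Ty: "blinfun_apply T y = y"
    using x unfolding y_def[symmetric] by (simp add: D_def blinfun.bilinear_simps)
  \<comment> \<open>This relation transfers the convergence of the means at \<open>x\<close> to
    \<open>z\<close>.\<close>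
  have A: "blinfun_apply (s_means s T (Suc n)) x = x - (s n / s (Suc n)) *\<^sub>R z n" for n
    unfolding s_means_Suc[OF s(1)] op_convolution_commutes_diff_id
    using s0 by (simp add: blinfun.bilinear_simps z_def y_def D_def)
  have Px: "(\<lambda>n. blinfun_apply (s_means s T (Suc n)) x) \<longlonglongrightarrow> blinfun_apply P x"
    by (rule LIMSEQ_Suc[where f = "\<lambda>n. blinfun_apply (s_means s T n) x"])
      (intro tendsto_intros blinfun.tendsto P)
  have "(\<lambda>n. (s (n + 1) / s n) *\<^sub>R (x - blinfun_apply (s_means s T (Suc n)) x)) \<longlonglongrightarrow>
      1 *\<^sub>R (x - blinfun_apply P x)"
    by (intro tendsto_intros s(2) Px)
  then have z: "z \<longlonglongrightarrow> x - blinfun_apply P x"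
    unfolding A using s0 by simp
  have "z (Suc n) = y + (s n / s (Suc n)) *\<^sub>R z n" for n
  proof -
    have "T o\<^sub>L op_convolution s T n = op_convolution s T n o\<^sub>L T"
      by (rule op_convolution_commutes) simp
    then have "blinfun_apply (T o\<^sub>L op_convolution s T n) y = blinfun_apply (op_convolution s T n) y"
      by (simp only: blinfun_apply_blinfun_compose Ty)
    then show ?thesis
      using s0 by (simp add: z_def op_convolution_Suc blinfun.bilinear_simps scaleR_add_right)
  qed
  moreover have "(\<lambda>n. y + (s n / s (Suc n)) *\<^sub>R z n) \<longlonglongrightarrow> y + 1 *\<^sub>R (x - blinfun_apply P x)"
    by (intro tendsto_intros ratio_pred_tendsto_1 s(2) z)
  ultimately have "(\<lambda>n. z (Suc n)) \<longlonglongrightarrow> y + (x - blinfun_apply P x)" by simp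
  with LIMSEQ_Suc[OF z] have "y + (x - blinfun_apply P x) = x - blinfun_apply P x"
    by (rule LIMSEQ_unique[THEN sym])
  then show ?thesis by (simp add: y_def)
qed

lemma kernel_power_subset_kernel:
  assumes "\<And>x. blinfun_apply D (blinfun_apply D x) = 0 \<Longrightarrow> blinfun_apply D x = 0"
    and "blinfun_apply (blinfun_power D m) x = 0"
  shows "blinfun_apply D x = 0"
  using assms(2)
proof (induction m)
  case 0
  then show ?case by (simp add: blinfun.zero_right)
next
  case (Suc m)
  show ?case
  proof (cases m)
    case (Suc k)
    then show ?thesis using Suc.prems assms(1) by (intro Suc.IH) simp
  qed (use Suc.prems in simp)
qed

text \<open>The operator \<open>S\<close> comes from a single mean within distance \<open>1\<close>
  of \<open>P\<close>: the identity minus that mean is \<open>D\<close> times a bounded operator,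
  and a Neumann series corrects the error.\<close>

lemma s_means_limit:
  fixes T :: "'a::banach \<Rightarrow>\<^sub>L 'a"
  defines "D \<equiv> id_blinfun - T"
  assumes s: "\<And>n. 0 < s n" "(\<lambda>n. s (n + 1) / s n) \<longlonglongrightarrow> 1"
    and dec: "(\<lambda>n. blinfun_power D m o\<^sub>L s_means s T n) \<longlonglongrightarrow> 0"
    and P: "s_means s T \<longlonglongrightarrow> P"
  obtains S where "D o\<^sub>L P = 0" "P o\<^sub>L D = 0" "id_blinfun = P + (D o\<^sub>L S)"
    "\<And>x. blinfun_apply D x = 0 \<Longrightarrow> blinfun_apply P x = x"
proof -
  have s0: "s n \<noteq> 0" for n using s(1)[of n] by simp
  have P1: "(\<lambda>n. s_means s T (Suc n)) \<longlonglongrightarrow> P" using P by (rule LIMSEQ_Suc)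
  note A = s_means_Suc[OF s(1), where T = T, folded D_def]
  have comm: "D o\<^sub>L op_convolution s T n = op_convolution s T n o\<^sub>L D" for n
    unfolding D_def by (rule op_convolution_commutes_diff_id)
  have "blinfun_power D m o\<^sub>L P = 0"
    by (rule LIMSEQ_unique[OF _ dec]) (intro blinfun_compose.tendsto tendsto_const P)
  then have "blinfun_apply (blinfun_power D m) (blinfun_apply P x) = 0" for x
    by (metis blinfun_apply_blinfun_compose blinfun.zero_left)
  then have DPx: "blinfun_apply D (blinfun_apply P x) = 0" for x
    using kernel_square_subset_kernel[OF s P, folded D_def] by (rule kernel_power_subset_kernel[rotated])
  then have DP: "D o\<^sub>L P = 0" by (intro blinfun_eqI) simp
  have "D o\<^sub>L s_means s T (Suc n) = s_means s T (Suc n) o\<^sub>L D" for n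
    unfolding A by (simp add: blinfun_compose.diff_left blinfun_compose.diff_right
        blinfun_compose.scaleR_left blinfun_compose.scaleR_right comm[symmetric] blinfun_compose_assoc)
  moreover have "(\<lambda>n. D o\<^sub>L s_means s T (Suc n)) \<longlonglongrightarrow> (D o\<^sub>L P)"
    "(\<lambda>n. s_means s T (Suc n) o\<^sub>L D) \<longlonglongrightarrow> (P o\<^sub>L D)"
    by (intro blinfun_compose.tendsto tendsto_const P1)+
  ultimately have "P o\<^sub>L D = D o\<^sub>L P" by (simp add: LIMSEQ_unique)
  with DP have PD: "P o\<^sub>L D = 0" by simp
  have fixed: "blinfun_apply P x = x" if "blinfun_apply D x = 0" for x
  proof -
    have "blinfun_apply (s_means s T (Suc n)) x = x" for n
      unfolding A comm using that by (simp add: blinfun.bilinear_simps)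
    moreover have "(\<lambda>n. blinfun_apply (s_means s T (Suc n)) x) \<longlonglongrightarrow> blinfun_apply P x"
      by (intro blinfun.tendsto tendsto_const P1)
    ultimately show ?thesis by (simp add: LIMSEQ_const_iff)
  qed
  have PP: "P o\<^sub>L P = P" by (rule blinfun_eqI) (simp add: fixed DPx)
  have "(\<lambda>n. norm (s_means s T (Suc n) - P)) \<longlonglongrightarrow> 0"
    using P1 by (intro tendsto_norm_zero LIM_zero)
  then have "eventually (\<lambda>n. norm (s_means s T (Suc n) - P) < 1) sequentially"
    by (rule order_tendstoD(2)) simp
  then obtain n where n: "norm (s_means s T (Suc n) - P) < 1"
    by (auto simp: eventually_sequentially)
  define E where "E = s_means s T (Suc n) - P"
  obtain V where V: "(id_blinfun - E) o\<^sub>L V = id_blinfun"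
    using neumann_series_norm_less_1[of E] n by (auto simp: E_def)
  \<comment> \<open>Composing this on the right with the inverse \<open>V\<close> gives the required
    splitting, provided \<open>P o\<^sub>L V = P\<close>. That follows from
    \<open>P o\<^sub>L (id_blinfun - E) = P\<close>, which uses that \<open>P\<close> is idempotent
    and annihilates the range of \<open>D\<close>.\<close>
  have idE: "id_blinfun - E = P + (D o\<^sub>L (1 / s (Suc n)) *\<^sub>R op_convolution s T n)"
    by (simp add: E_def A blinfun_compose.scaleR_right)
  have "P o\<^sub>L (id_blinfun - E) = P"
    unfolding idE by (simp add: blinfun_compose.add_right PP flip: blinfun_compose_assoc) (simp add: PD)
  then have "P o\<^sub>L V = P"
    using V by (metis blinfun_compose_assoc blinfun_compose_id(2))
  then have "id_blinfun = P + (D o\<^sub>L ((1 / s (Suc n)) *\<^sub>R op_convolution s T n o\<^sub>L V))"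
    using V unfolding idE by (simp add: blinfun_compose.add_left blinfun_compose_assoc)
  then show thesis using DP PD fixed by (intro that)
qed

text \<open>Since \<open>S D D = D\<close>, composition with \<open>S\<close> cancels factors of
  \<open>D\<close> one at a time until a single one remains. A last \<open>S\<close> turns
  \<open>D A\<close> into \<open>A - P\<close> for each mean \<open>A\<close> of positive index,
  because then \<open>P A = P\<close>.\<close>

lemma s_means_converge_of_reduced_resolvent:
  fixes T :: "'a::banach \<Rightarrow>\<^sub>L 'a"
  defines "D \<equiv> id_blinfun - T"
  assumes s: "\<And>n. 0 < s n"
    and dec: "(\<lambda>n. blinfun_power D (Suc m) o\<^sub>L s_means s T n) \<longlonglongrightarrow> 0"
    and DP: "D o\<^sub>L P = 0" and PD: "P o\<^sub>L D = 0"
    and DS: "D o\<^sub>L S = id_blinfun - P" and SD: "S o\<^sub>L D = id_blinfun - P"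
  shows "s_means s T \<longlonglongrightarrow> P"
proof -
  have SDD: "S o\<^sub>L (D o\<^sub>L D) = D"
    by (simp add: SD blinfun_compose.diff_left PD flip: blinfun_compose_assoc)
  have "(\<lambda>n. D o\<^sub>L s_means s T n) \<longlonglongrightarrow> 0"
    using dec
  proof (induction m)
    case (Suc m)
    have "S o\<^sub>L blinfun_power D (Suc (Suc m)) = blinfun_power D (Suc m)"
      using SDD by (simp flip: blinfun_compose_assoc)
    moreover have "(\<lambda>n. S o\<^sub>L (blinfun_power D (Suc (Suc m)) o\<^sub>L s_means s T n)) \<longlonglongrightarrow> (S o\<^sub>L 0)"
      by (intro blinfun_compose.tendsto tendsto_const Suc.prems)
    ultimately show ?case by (intro Suc.IH) (simp del: blinfun_power_simps flip: blinfun_compose_assoc)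
  qed simp
  then have "(\<lambda>n. S o\<^sub>L (D o\<^sub>L s_means s T n)) \<longlonglongrightarrow> (S o\<^sub>L 0)"
    by (intro blinfun_compose.tendsto tendsto_const)
  then have "(\<lambda>n. S o\<^sub>L (D o\<^sub>L s_means s T (Suc n))) \<longlonglongrightarrow> 0"
    by (intro LIMSEQ_Suc[where f = "\<lambda>n. S o\<^sub>L (D o\<^sub>L s_means s T n)"]) simp
  moreover have "S o\<^sub>L (D o\<^sub>L s_means s T (Suc n)) = s_means s T (Suc n) - P" for n
  proof -
    have "P o\<^sub>L s_means s T (Suc n) = P"
      unfolding s_means_Suc[OF s, where T = T, folded D_def]
      by (simp add: blinfun_compose.diff_right blinfun_compose.scaleR_right PD flip: blinfun_compose_assoc)
    then show ?thesis
      by (simp add: SD blinfun_compose.diff_left flip: blinfun_compose_assoc)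
  qed
  ultimately have "(\<lambda>n. s_means s T (Suc n)) \<longlonglongrightarrow> P" by (simp add: LIM_zero_iff)
  then show ?thesis by (simp only: filterlim_sequentially_Suc)
qed

section \<open>Spectral radius bound, equivalence of the four conditions, and the limit
  projection\<close>

theorem theorem6p7:
  fixes T :: "'a::complex_banach \<Rightarrow>\<^sub>L 'a" and b :: "nat \<Rightarrow> real"
  assumes "(UNIV :: 'a set) \<noteq> {0}"
    and "T \<in> L_ops"
    and "\<forall>n. 0 < b n"
    and "growth_order b < \<infinity>"
    and "filterlim b at_top sequentially"
    and "(\<lambda>n. norm (blinfun_power T n) / b n) \<longlonglongrightarrow> 0"
  shows "op_spectral_radius T \<le> 1 \<and>
    (\<forall>s :: nat \<Rightarrow> real.
      mono s \<and> (\<forall>n. 0 < s n) \<and> filterlim s at_top sequentially \<and>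
      (\<lambda>n. s (n + 1) / s n) \<longlonglongrightarrow> 1 \<and>
      (\<exists>q\<ge>2. (Delta ^^ q) s \<in> ell1) \<and>
      bounded (range (\<lambda>n. b n / s n))
      \<longrightarrow>
      (\<lambda>n. norm (blinfun_power T n) / s n) \<longlonglongrightarrow> 0 \<and>
      (let N = op_kernel (id_blinfun - T);
           R = op_range (id_blinfun - T);
           C1 = (\<exists>P\<in>L_ops. s_means s T \<longlonglongrightarrow> P);
           C2 = (1 \<in> resolvent_set T \<or> simple_pole (resolvent T) (resolvent_set T) 1);
           C3 = direct_sum_decomp N R;
           C4 = (closed R \<and> direct_sum_decomp N R)
       in (C1 \<longleftrightarrow> C2) \<and> (C2 \<longleftrightarrow> C3) \<and> (C3 \<longleftrightarrow> C4) \<and>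
          (\<forall>P\<in>L_ops. C1 \<and> C2 \<and> C3 \<and> C4 \<and> s_means s T \<longlonglongrightarrow> P \<longrightarrow> is_projection P N R)))"
proof (intro conjI allI impI)
  have b: "0 < b n" for n using assms(3) by blast
  show "op_spectral_radius T \<le> 1"
  proof -
    obtain m C where C: "\<And>n. 1 \<le> n \<Longrightarrow> b n \<le> C * real n ^ m"
      using growth_order_finite_imp_bound[OF assms(4)] by blast
    have "Bseq (\<lambda>n. norm (blinfun_power T n) / b n)"
      by (rule convergent_imp_Bseq[OF convergentI[OF assms(6)]])
    then obtain K where K: "0 < K" "\<And>n. norm (norm (blinfun_power T n) / b n) \<le> K"
      by (auto simp: Bseq_def)
    have "norm (blinfun_power T n) \<le> K * C * real n ^ m" if "1 \<le> n" for n
    proof -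
      have "norm (blinfun_power T n) \<le> K * b n"
        using K(2)[of n] b[of n] by (simp add: pos_divide_le_eq)
      also have "\<dots> \<le> K * (C * real n ^ m)" using K(1) C[OF that] by simp
      finally show ?thesis by simp
    qed
    then have "z \<in> resolvent_set T" if "1 < cmod z" for z
      using in_resolvent_set_if_polynomial_growth[OF assms(2) _ that] by blast
    then have "cmod z \<le> 1" if "z \<in> op_spectrum T" for z
      using that by (force simp: op_spectrum_def)
    then show ?thesis
      unfolding op_spectral_radius_def using op_spectrum_nonempty[OF assms(1), of T]
      by (intro cSup_least) auto
  qed
  fix s :: "nat \<Rightarrow> real"
  assume "mono s \<and> (\<forall>n. 0 < s n) \<and> filterlim s at_top sequentially \<and>
      (\<lambda>n. s (n + 1) / s n) \<longlonglongrightarrow> 1 \<and> (\<exists>q\<ge>2. (Delta ^^ q) s \<in> ell1) \<and>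
      bounded (range (\<lambda>n. b n / s n))"
  then obtain q where s: "mono s" "\<And>n. 0 < s n" "(\<lambda>n. s (n + 1) / s n) \<longlonglongrightarrow> 1"
    and q: "2 \<le> q" "(Delta ^^ q) s \<in> ell1" and bs: "bounded (range (\<lambda>n. b n / s n))"
    by blast
  show T_s: "(\<lambda>n. norm (blinfun_power T n) / s n) \<longlonglongrightarrow> 0"
  proof -
    obtain B where "\<And>n. norm (b n / s n) \<le> B" using bs by (auto simp: bounded_iff)
    then have "(\<lambda>n. norm (blinfun_power T n) / b n * (b n / s n)) \<longlonglongrightarrow> 0"
      by (intro lim_null_mult_right_bounded[OF assms(6)] always_eventually allI)
    moreover have "norm (blinfun_power T n) / b n * (b n / s n) = norm (blinfun_power T n) / s n" for n
      using b[of n] by simp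
    ultimately show ?thesis by (simp only:)
  qed
  \<comment> \<open>The exponent in \<open>dec\<close> is \<open>q - 1 = Suc m\<close>, so at least
    one factor of \<open>D\<close> is present, as the convergence criterion requires.\<close>
  define m where "m = q - 2"
  have "(Delta ^^ Suc (Suc m)) s \<in> ell1"
    using q by (metis One_nat_def Suc_1 Suc_eq_plus1_left add_Suc le_add_diff_inverse m_def)
  note dec = power_compose_s_means_tendsto_0[OF s this T_s]
  define D where "D = id_blinfun - T"
  have LD: "D \<in> L_ops" unfolding D_def by (intro L_ops_closed assms(2))
  have proj: "is_projection P (op_kernel D) (op_range D)" if "P \<in> L_ops" "s_means s T \<longlonglongrightarrow> P" for P
    using s_means_limit[OF s(2,3) dec that(2), folded D_def] direct_sum_of_projection(4) that(1) by metis
  then have C14: "closed (op_range D) \<and> direct_sum_decomp (op_kernel D) (op_range D)"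
    if "\<exists>P\<in>L_ops. s_means s T \<longlonglongrightarrow> P"
    using that by (auto simp: is_projection_def)
  have C3_rest: "(\<exists>P\<in>L_ops. s_means s T \<longlonglongrightarrow> P) \<and>
      (1 \<in> resolvent_set T \<or> simple_pole (resolvent T) (resolvent_set T) 1)"
    if ds: "direct_sum_decomp (op_kernel D) (op_range D)"
  proof -
    obtain P S where PS: "P \<in> L_ops" "S \<in> L_ops" "D o\<^sub>L P = 0" "P o\<^sub>L D = 0" "P o\<^sub>L S = 0"
      "S o\<^sub>L P = 0" "D o\<^sub>L S = id_blinfun - P" "S o\<^sub>L D = id_blinfun - P"
      using reduced_resolvent_of_direct_sum[OF LD ds] by blast
    have "s_means s T \<longlonglongrightarrow> P"
      by (rule s_means_converge_of_reduced_resolvent[OF s(2) dec PS(3,4,7,8)[unfolded D_def]])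
    \<comment> \<open>The alternative in (2) is decided by \<open>P\<close>: if it vanishes,
      \<open>S\<close> is a two-sided inverse of \<open>D\<close>; otherwise it is the residue of a
      simple pole.\<close>
    moreover have "1 \<in> resolvent_set T" if "P = 0"
      using PS(2,7,8) that by (auto simp: resolvent_set_def is_inverse_op_def D_def)
    moreover have "simple_pole (resolvent T) (resolvent_set T) 1" if "P \<noteq> 0"
      by (rule simple_pole_of_reduced_resolvent[OF assms(2) PS[unfolded D_def] that])
    ultimately show ?thesis using PS(1) by blast
  qed
  have C23: "direct_sum_decomp (op_kernel D) (op_range D)"
    if "1 \<in> resolvent_set T \<or> simple_pole (resolvent T) (resolvent_set T) 1"
    using that direct_sum_of_resolvent_set simple_pole_imp_direct_sum[OF assms(2)]
    unfolding D_def by blast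
  show "let N = op_kernel (id_blinfun - T);
           R = op_range (id_blinfun - T);
           C1 = (\<exists>P\<in>L_ops. s_means s T \<longlonglongrightarrow> P);
           C2 = (1 \<in> resolvent_set T \<or> simple_pole (resolvent T) (resolvent_set T) 1);
           C3 = direct_sum_decomp N R;
           C4 = (closed R \<and> direct_sum_decomp N R)
       in (C1 \<longleftrightarrow> C2) \<and> (C2 \<longleftrightarrow> C3) \<and> (C3 \<longleftrightarrow> C4) \<and>
          (\<forall>P\<in>L_ops. C1 \<and> C2 \<and> C3 \<and> C4 \<and> s_means s T \<longlonglongrightarrow> P \<longrightarrow> is_projection P N R)"
    \<comment> \<open>The implications close up through (3): (1) gives (4), which contains (3); (3)
      gives (1) and (2); and (2) gives (3).\<close>
    unfolding Let_def D_def[symmetric]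
    using C14 C3_rest C23 proj by blast
qed

end
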